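(* Let $p\ge1$, $\lambda\in(0,1)$, $\beta_0\in\mathbb R^p\setminus\{0\}$, $\sigma_\epsilon>0$, let $f$ be the density of $\mathcal N(0,\sigma_\epsilon^2)$, and let $X\sim\mathcal N(\mu_X,\Sigma_X)$ with $\mu_X\ne0$ and $\Sigma_X$ positive definite, with density $f^X$; let $f^Y(y)=\int f(y-\beta_0^\top x)f^X(x)dx$. Define $$\Gamma_1=\int\frac{\big(\int xf'(y-\beta_0^\top x)f^X(x)dx\big)\big(\int x^\top f'(y-\beta_0^\top x)f^X(x)dx\big)}{f^Y(y)}\,dy,$$ $$\Gamma_2=\int\Big(\int\frac{f(y-\beta_0^\top x)\int zf'(y-\beta_0^\top z)f^X(z)dz}{f^Y(y)}dy\Big)\Big(\int\frac{f(y-\beta_0^\top x)\int z^\top f'(y-\beta_0^\top z)f^X(z)dz}{f^Y(y)}dy\Big)f^X(x)\,dx,$$ $\Sigma_2=\big(\int (f'(t))^2/f(t)\,dt\big)\mathbb E[XX^\top]$, $\Sigma_{\mathrm{OLS}}=\Sigma_2^{-1}$, $$\tilde\Sigma_{\mathrm{SSL}}=\Big(\tfrac1\lambda\Gamma_1+\Sigma_2\Big)^{-1}\Big(\tfrac1\lambda(\Gamma_1+\Gamma_2)+\Sigma_2\Big)\Big(\tfrac1\lambda\Gamma_1+\Sigma_2\Big)^{-1},\qquad G=\Big(\sqrt{\det\tilde\Sigma_{\mathrm{SSL}}/\det\Sigma_{\mathrm{OLS}}}\Big)^{-1}.$$ Put $\zeta=\frac{\mu_X^\top\beta_0}{\sqrt{\beta_0^\top\Sigma_X\beta_0}\sqrt{\mu_X^\top\Sigma_X^{-1}\mu_X}}$,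 $\rho=\frac{1}{\mu_X^\top\Sigma_X^{-1}\mu_X}$, $\eta=\frac{\beta_0^\top\Sigma_X\beta_0}{\sigma_\epsilon^2}$. Then the maximizer of $\beta\mapsto\sum_{k=1}^m\log f(Y_k-\beta^\top X_k)$ coincides with the ordinary least squares estimator, and $$G=\frac{1+\frac1\lambda\Big(\frac{1}{1+\eta}\frac{1}{1+\rho}+\frac{2\eta}{(\eta+1)^2}\big(1-\frac{\zeta^2}{1+\rho}\big)\Big)+\frac{1}{\lambda^2}\frac{1-\zeta^2}{1+\rho}\frac{2\eta}{(\eta+1)^3}}{\sqrt{1+\frac1\lambda\Big(\frac{1}{1+\eta}\frac{1}{1+\rho}\big(1+\frac{\eta}{\eta+1}\big)+\frac{2\eta}{(\eta+1)^2}\big(1-\frac{\zeta^2}{1+\rho}\big)\big(1+\frac{\eta^2}{(\eta+1)^2}\big)\Big)+\frac{1}{\lambda^2}\frac{1-\zeta^2}{1+\rho}\frac{2\eta}{(\eta+1)^3}\big(1+\frac{\eta^2}{(\eta+1)^2}\big)\big(1+\frac{\eta}{\eta+1}\big)}}.$$ If instead $\mu_X=0$ (and otherwise the same setting), then $$G=\frac{1+\frac2\lambda\frac{\eta}{(\eta+1)^2}}{\sqrt{1+\frac2\lambda\Big(\frac{\eta}{(\eta+1)^2}+\frac{\eta^3}{(\eta+1)^4}\Big)}}.$$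
   Context: Here $(X_k,Y_k)$ are pairs from the linear model $Y=\beta_0^\top X+\epsilon$ with $\epsilon\sim\mathcal N(0,\sigma_\epsilon^2)$ independent of $X$. $G$ is the "statistical gain": the inverse ratio of the volumes of asymptotic confidence ellipsoids of the semi-supervised estimator (combining $m$ matched pairs and $n$ unmatched observations with $m/n\to\lambda$) and of the matched-sample maximum likelihood estimator. *)

theory Defs
  imports "HOL-Probability.Probability"
begin

definition outer :: "real^'n \<Rightarrow> real^'n \<Rightarrow> real^'n^'n" where
  "outer x y = (\<chi> i j. x $ i * y $ j)"

definition pos_def_mat :: "real^'n^'n \<Rightarrow> bool" where
  "pos_def_mat A \<longleftrightarrow> transpose A = A \<and> (\<forall>x. x \<noteq> 0 \<longrightarrow> x \<bullet> (A *v x) > 0)"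

definition mvn_density :: "real^'n \<Rightarrow> real^'n^'n \<Rightarrow> real^'n \<Rightarrow> real" where
  "mvn_density \<mu> S x =
     exp (- ((x - \<mu>) \<bullet> (matrix_inv S *v (x - \<mu>))) / 2) / sqrt ((2 * pi) ^ CARD('n) * det S)"

definition fprime :: "real \<Rightarrow> real \<Rightarrow> real" where
  "fprime \<sigma> = deriv (normal_density 0 \<sigma>)"

definition fY :: "real \<Rightarrow> real^'n \<Rightarrow> real^'n \<Rightarrow> real^'n^'n \<Rightarrow> real \<Rightarrow> real" where
  "fY \<sigma> \<beta> \<mu> S y = (LINT x|lborel. normal_density 0 \<sigma> (y - \<beta> \<bullet> x) * mvn_density \<mu> S x)"

definition Avec :: "real \<Rightarrow> real^'n \<Rightarrow> real^'n \<Rightarrow> real^'n^'n \<Rightarrow> real \<Rightarrow> real^'n" where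
  "Avec \<sigma> \<beta> \<mu> S y =
     integral\<^sup>L lborel (\<lambda>x. (fprime \<sigma> (y - \<beta> \<bullet> x) * mvn_density \<mu> S x) *\<^sub>R x)"

definition Gamma1 :: "real \<Rightarrow> real^'n \<Rightarrow> real^'n \<Rightarrow> real^'n^'n \<Rightarrow> real^'n^'n" where
  "Gamma1 \<sigma> \<beta> \<mu> S =
     integral\<^sup>L lborel (\<lambda>y::real. (1 / fY \<sigma> \<beta> \<mu> S y) *\<^sub>R outer (Avec \<sigma> \<beta> \<mu> S y) (Avec \<sigma> \<beta> \<mu> S y))"

definition Bvec :: "real \<Rightarrow> real^'n \<Rightarrow> real^'n \<Rightarrow> real^'n^'n \<Rightarrow> real^'n \<Rightarrow> real^'n" where
  "Bvec \<sigma> \<beta> \<mu> S x =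
     integral\<^sup>L lborel (\<lambda>y::real. (normal_density 0 \<sigma> (y - \<beta> \<bullet> x) / fY \<sigma> \<beta> \<mu> S y) *\<^sub>R Avec \<sigma> \<beta> \<mu> S y)"

definition Gamma2 :: "real \<Rightarrow> real^'n \<Rightarrow> real^'n \<Rightarrow> real^'n^'n \<Rightarrow> real^'n^'n" where
  "Gamma2 \<sigma> \<beta> \<mu> S =
     integral\<^sup>L lborel (\<lambda>x. mvn_density \<mu> S x *\<^sub>R outer (Bvec \<sigma> \<beta> \<mu> S x) (Bvec \<sigma> \<beta> \<mu> S x))"

definition Sigma2 :: "real \<Rightarrow> real^'n \<Rightarrow> real^'n^'n \<Rightarrow> real^'n^'n" where
  "Sigma2 \<sigma> \<mu> S =
     (LINT t|lborel. (fprime \<sigma> t)\<^sup>2 / normal_density 0 \<sigma> t)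
       *\<^sub>R integral\<^sup>L lborel (\<lambda>x. mvn_density \<mu> S x *\<^sub>R outer x x)"

definition Sigma_OLS :: "real \<Rightarrow> real^'n \<Rightarrow> real^'n^'n \<Rightarrow> real^'n^'n" where
  "Sigma_OLS \<sigma> \<mu> S = matrix_inv (Sigma2 \<sigma> \<mu> S)"

definition Sigma_SSL :: "real \<Rightarrow> real \<Rightarrow> real^'n \<Rightarrow> real^'n \<Rightarrow> real^'n^'n \<Rightarrow> real^'n^'n" where
  "Sigma_SSL lam \<sigma> \<beta> \<mu> S =
     (let M = matrix_inv ((1 / lam) *\<^sub>R Gamma1 \<sigma> \<beta> \<mu> S + Sigma2 \<sigma> \<mu> S)
      in M ** ((1 / lam) *\<^sub>R (Gamma1 \<sigma> \<beta> \<mu> S + Gamma2 \<sigma> \<beta> \<mu> S) + Sigma2 \<sigma> \<mu> S) ** M)"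

definition gain :: "real \<Rightarrow> real \<Rightarrow> real^'n \<Rightarrow> real^'n \<Rightarrow> real^'n^'n \<Rightarrow> real" where
  "gain lam \<sigma> \<beta> \<mu> S =
     inverse (sqrt (det (Sigma_SSL lam \<sigma> \<beta> \<mu> S) / det (Sigma_OLS \<sigma> \<mu> S)))"

end

theory Submission
  imports Defs
begin

text \<open>Since \<open>ln f(t)\<close> is a constant minus \<open>t\<^sup>2 / (2 \<sigma>\<^sup>2)\<close>, maximising the likelihood is minimising the sum of
  squares. For the gain, choose a square root \<open>S = L L\<^sup>T\<close> with \<open>L\<^sup>T \<beta> = \<tau> e\<^sub>k\<close>, \<open>\<tau>\<^sup>2 = \<beta>\<^sup>T S \<beta>\<close>. In the coordinates
  \<open>x = \<mu> + L z\<close> all inner integrals reduce to Gaussian moments in the single variable \<open>z\<^sub>k\<close>. With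
  \<open>s\<^sup>2 = \<tau>\<^sup>2 + \<sigma>\<^sup>2\<close>, \<open>v = S \<beta>\<close> and \<open>h\<close> the density of \<open>N(0, s\<^sup>2)\<close>, the inner integral of \<open>\<Gamma>\<^sub>1\<close> is \<open>h'(u) \<mu> - h''(u) v\<close>
  at \<open>u = y - \<beta> \<bullet> \<mu>\<close>. Hence \<open>\<Gamma>\<^sub>1 = s\<^sup>-\<^sup>2 \<mu> \<mu>\<^sup>T + 2 s\<^sup>-\<^sup>4 v v\<^sup>T\<close>, and conditioning on \<open>x\<close> shrinks the two terms by
  \<open>\<eta>/(\<eta>+1)\<close> and its square to give \<open>\<Gamma>\<^sub>2\<close>. All matrices involved are therefore multiples of rank-two
  perturbations of \<open>S\<close>, whose determinants are explicit.\<close>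

section \<open>Linear change of variables for Lebesgue measure\<close>

lemma prod_Basis_cart:
  "(\<Prod>b\<in>(Basis::(real^'n) set). g b) = (\<Prod>i\<in>(UNIV::'n set). g (axis i 1))"
proof -
  have B: "(Basis::(real^'n) set) = (\<lambda>i. axis i 1) ` UNIV"
    by (auto simp: Basis_vec_def)
  show ?thesis
    unfolding B by (subst prod.reindex) (auto simp: inj_on_def axis_eq_axis)
qed

text \<open>By Fubini the coordinate \<open>m\<close> can be integrated first. With the other
  coordinates fixed, \<open>x $ n\<close> is a constant, so the shear acts as a translation of the
  inner variable and leaves its integral unchanged.\<close>

lemma nn_integral_lborel_shear:
  fixes F :: "real^'n \<Rightarrow> ennreal"
  assumes [measurable]: "F \<in> borel_measurable borel" and mn: "m \<noteq> n"
  shows "(\<integral>\<^sup>+x. F (x + (x $ n) *\<^sub>R axis m 1) \<partial>lborel) = (\<integral>\<^sup>+x. F x \<partial>lborel)"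
proof -
  interpret product_sigma_finite "\<lambda>_::real^'n. lborel :: real measure" ..
  let ?B = "Basis :: (real^'n) set" and ?e = "axis m 1 :: real^'n"
  let ?v = "\<lambda>f. \<Sum>b\<in>?B. f b *\<^sub>R b"
  have eB: "?e \<in> ?B" by (simp add: axis_in_Basis_iff)
  have iB: "insert ?e (?B - {?e}) = ?B" using eB by auto
  \<comment> \<open>Splits off the direction \<open>?e\<close>. The base point has its
    \<open>?e\<close> entry set to 0, so it does not depend on the inner variable.\<close>
  have PiM_split: "(\<integral>\<^sup>+f. G (?v f) \<partial>(\<Pi>\<^sub>M b\<in>?B. lborel))
      = (\<integral>\<^sup>+f. (\<integral>\<^sup>+y. G (?v (f(?e := 0)) + y *\<^sub>R ?e) \<partial>lborel) \<partial>(\<Pi>\<^sub>M b\<in>?B-{?e}. lborel))"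
    if [measurable]: "G \<in> borel_measurable borel" for G :: "real^'n \<Rightarrow> ennreal"
  proof -
    have v: "?v (f(?e := y)) = ?v (f(?e := 0)) + y *\<^sub>R ?e" for f :: "real^'n \<Rightarrow> real" and y
      using eB by (simp add: sum.remove[of ?B ?e])
    have "(\<integral>\<^sup>+f. G (?v f) \<partial>(\<Pi>\<^sub>M b\<in>insert ?e (?B-{?e}). lborel))
        = (\<integral>\<^sup>+f. (\<integral>\<^sup>+y. G (?v (f(?e := y))) \<partial>lborel) \<partial>(\<Pi>\<^sub>M b\<in>?B-{?e}. lborel))"
      by (rule product_nn_integral_insert) (auto simp: iB)
    then show ?thesis unfolding iB by (subst (asm) v)
  qed
  have n: "(w + y *\<^sub>R ?e) $ n = w $ n" for w y
    using mn by (simp add: axis_def)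
  have "(\<integral>\<^sup>+x. F (x + (x $ n) *\<^sub>R ?e) \<partial>lborel)
      = (\<integral>\<^sup>+f. (\<lambda>x. F (x + (x $ n) *\<^sub>R ?e)) (?v f) \<partial>(\<Pi>\<^sub>M b\<in>?B. lborel))"
    by (subst lborel_eq) (simp add: nn_integral_distr)
  also have "\<dots> = (\<integral>\<^sup>+f. (\<integral>\<^sup>+y. F (?v (f(?e := 0)) + y *\<^sub>R ?e + (?v (f(?e := 0)) $ n) *\<^sub>R ?e) \<partial>lborel)
       \<partial>(\<Pi>\<^sub>M b\<in>?B-{?e}. lborel))"
    by (subst PiM_split) (simp_all add: n del: fun_upd_apply vector_add_component vector_scaleR_component)
  also have "\<dots> = (\<integral>\<^sup>+f. (\<integral>\<^sup>+y. F (?v (f(?e := 0)) + y *\<^sub>R ?e) \<partial>lborel)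
       \<partial>(\<Pi>\<^sub>M b\<in>?B-{?e}. lborel))"
  proof (rule nn_integral_cong)
    fix f :: "real^'n \<Rightarrow> real"
    let ?c = "?v (f(?e := 0)) $ n"
    show "(\<integral>\<^sup>+y. F (?v (f(?e := 0)) + y *\<^sub>R ?e + ?c *\<^sub>R ?e) \<partial>lborel)
        = (\<integral>\<^sup>+y. F (?v (f(?e := 0)) + y *\<^sub>R ?e) \<partial>lborel)"
      by (subst nn_integral_real_affine[of "\<lambda>y. F (?v (f(?e := 0)) + y *\<^sub>R ?e)" 1 ?c])
         (auto simp: algebra_simps simp del: fun_upd_apply)
  qed
  also have "\<dots> = (\<integral>\<^sup>+f. F (?v f) \<partial>(\<Pi>\<^sub>M b\<in>?B. lborel))"
    by (rule PiM_split[symmetric]) simp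
  also have "\<dots> = (\<integral>\<^sup>+x. F x \<partial>lborel)"
    by (subst (2) lborel_eq) (simp add: nn_integral_distr)
  finally show ?thesis .
qed

text \<open>Lebesgue measure is determined by its values on boxes. A swap is an involution, so the
  preimage of a box is the box with swapped corners, and its volume is the same product with two
  factors exchanged.\<close>

lemma distr_lborel_transpose_coords:
  fixes m n :: "'n::finite"
  shows "distr lborel borel (\<lambda>x::real^'n. \<chi> i. x $ Transposition.transpose m n i) = lborel"
    (is "distr _ _ ?h = _")
proof (rule lborel_eqI[symmetric])
  have lin: "linear ?h"
    by (rule linearI) (simp_all add: plus_vec_def scaleR_vec_def)
  then have [measurable]: "?h \<in> borel_measurable borel"
    by (intro borel_measurable_continuous_onI linear_continuous_on linear_linear[THEN iffD2])
  fix l u :: "real^'n" assume le: "\<And>b. b \<in> Basis \<Longrightarrow> l \<bullet> b \<le> u \<bullet> b"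
  then have le': "l $ i \<le> u $ i" for i
    using le[of "axis i 1"] by (simp add: axis_in_Basis_iff inner_axis)
  have eq: "?h -` box l u = box (?h l) (?h u)"
    by (auto simp: mem_box_cart) (metis transpose_involutory)+
  show "emeasure (distr lborel borel ?h) (box l u) = ennreal (\<Prod>b\<in>Basis. (u - l) \<bullet> b)"
    unfolding emeasure_distr[OF \<open>?h \<in> borel_measurable borel\<close>[folded measurable_lborel2] borel_open[OF open_box]]
    using prod.permute [OF permutes_swap_id, where S=UNIV and g="\<lambda>i. (u - l)$i", of m n]
    by (simp add: eq emeasure_lborel_box_eq Basis_vec_def inner_axis le' prod_Basis_cart[unfolded Basis_vec_def, simplified] o_def)
qed simp

text \<open>The library's change of variables theorems need a well-ordered index type, hence this version
  for arbitrary finite index types.\<close>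

lemma nn_integral_lborel_linear:
  fixes f :: "real^'n \<Rightarrow> real^'n" and F :: "real^'n \<Rightarrow> ennreal"
  assumes "linear f" "det (matrix f) \<noteq> 0" "F \<in> borel_measurable borel"
  shows "(\<integral>\<^sup>+x. F x \<partial>lborel) = ennreal \<bar>det (matrix f)\<bar> * (\<integral>\<^sup>+x. F (f x) \<partial>lborel)"
proof -
  have meas: "g \<in> borel_measurable borel" if "linear g" for g :: "real^'n \<Rightarrow> real^'n"
    using that by (intro borel_measurable_continuous_onI linear_continuous_on linear_linear[THEN iffD2])
  \<comment> \<open>The determinant condition is part of the predicate, so maps with a zero row
    satisfy it vacuously and a composition passes it on to both factors. \<open>F\<close> is
    quantified inside because the composition case applies the hypothesis for \<open>g\<close> to
    \<open>F\<close> composed with \<open>f\<close>.\<close>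
  let ?P = "\<lambda>f::real^'n \<Rightarrow> real^'n. det (matrix f) \<noteq> 0 \<longrightarrow> (\<forall>F\<in>borel_measurable borel.
     (\<integral>\<^sup>+x. F x \<partial>lborel) = ennreal \<bar>det (matrix f)\<bar> * (\<integral>\<^sup>+x. F (f x) \<partial>lborel))"
  have "?P f"
  proof (rule induct_linear_elementary[OF \<open>linear f\<close>])
    fix f g :: "real^'n \<Rightarrow> real^'n"
    assume fg: "linear f" "linear g" "?P f" "?P g"
    have m: "matrix (f \<circ> g) = matrix f ** matrix g"
      using fg(1,2) by (rule matrix_compose[rotated])
    show "?P (f \<circ> g)"
    proof (intro impI ballI)
      fix F :: "real^'n \<Rightarrow> ennreal" assume F: "F \<in> borel_measurable borel" and d: "det (matrix (f \<circ> g)) \<noteq> 0"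
      have Ff: "(\<lambda>x. F (f x)) \<in> borel_measurable borel"
        using F meas[OF fg(1)] by (rule measurable_compose[rotated])
      show "(\<integral>\<^sup>+x. F x \<partial>lborel) = ennreal \<bar>det (matrix (f \<circ> g))\<bar> * (\<integral>\<^sup>+x. F ((f \<circ> g) x) \<partial>lborel)"
        using fg(3,4) d F Ff by (auto simp: m det_mul abs_mult ennreal_mult' mult.assoc)
    qed
  next
    fix f :: "real^'n \<Rightarrow> real^'n" and i
    assume "linear f" and "\<And>x. f x $ i = 0"
    then have "det (matrix f) = 0"
      by (intro det_zero_row[of i]) (simp add: row_def matrix_def vec_eq_iff)
    then show "?P f" by simp
  next
    fix c :: "'n \<Rightarrow> real"
    let ?f = "\<lambda>x::real^'n. \<chi> i. c i * x $ i"
    have d: "det (matrix ?f) = (\<Prod>i\<in>UNIV. c i)"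
      by (subst det_diagonal) (auto simp: matrix_def axis_def)
    show "?P ?f"
    proof (intro impI ballI)
      fix F :: "real^'n \<Rightarrow> ennreal" assume F[measurable]: "F \<in> borel_measurable borel" and d': "det (matrix ?f) \<noteq> 0"
      then have c: "c i \<noteq> 0" for i by (simp add: d)
      \<comment> \<open>\<open>lborel_affine_euclidean\<close> indexes the scaling factors by basis
        vectors; \<open>c'\<close> carries \<open>c\<close> over to that indexing.\<close>
      define c' where "c' b = (\<Sum>i\<in>UNIV. c i * b $ i)" for b :: "real^'n"
      have c': "c' (axis i 1) = c i" for i
        by (simp add: c'_def axis_def if_distrib cong: if_cong)
      have f: "0 + (\<Sum>j\<in>Basis. (c' j * (x \<bullet> j)) *\<^sub>R j) = ?f x" for x
        by (simp add: euclidean_eq_iff[of _ "?f x"])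
           (auto simp: Basis_vec_def c' inner_axis inner_sum_left)
      have "c' j \<noteq> 0" if "j \<in> Basis" for j
        using that c by (auto simp: Basis_vec_def c')
      from lborel_affine_euclidean[of c' 0, OF this, unfolded f]
      have l: "lborel = density (distr lborel borel ?f) (\<lambda>_. (\<Prod>j\<in>Basis. \<bar>c' j\<bar>))" .
      have [measurable]: "?f \<in> borel_measurable borel"
        by (rule meas) (auto intro!: linearI simp: vec_eq_iff algebra_simps)
      show "(\<integral>\<^sup>+x. F x \<partial>lborel) = ennreal \<bar>det (matrix ?f)\<bar> * (\<integral>\<^sup>+x. F (?f x) \<partial>lborel)"
        by (subst l) (simp add: nn_integral_density nn_integral_distr nn_integral_cmult
             prod_Basis_cart c' d abs_prod)
    qed
  next
    fix m n :: 'n assume "m \<noteq> n"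
    let ?h = "\<lambda>x::real^'n. \<chi> i. x $ Transposition.transpose m n i"
    have "(\<chi> i j. if Transposition.transpose m n i = j then 1 else 0) = (\<chi> i j. if j = Transposition.transpose m n i then 1 else (0::real))"
      by (auto intro!: Cart_lambda_cong)
    then have "matrix ?h = transpose(\<chi> i j. mat 1 $ i $ Transposition.transpose m n j)"
      by (auto simp: matrix_eq transpose_def axis_def mat_def matrix_def)
    then have 1: "\<bar>det (matrix ?h)\<bar> = 1"
      by (simp add: det_permute_columns permutes_swap_id sign_swap_id abs_mult)
    have [measurable]: "?h \<in> borel_measurable borel"
      by (rule meas) (auto intro!: linearI simp: vec_eq_iff algebra_simps)
    show "?P ?h"
      unfolding 1 by (subst (2) distr_lborel_transpose_coords[of m n, symmetric])
        (simp add: nn_integral_distr)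
  next
    fix m n :: 'n assume mn: "m \<noteq> n"
    let ?h = "\<lambda>x::real^'n. \<chi> i. if i = m then x $ m + x $ n else x $ i"
    have h: "?h x = x + (x $ n) *\<^sub>R axis m 1" for x
      by (auto simp: vec_eq_iff axis_def)
    have "matrix ?h = (\<chi> k. if k = m then row m (mat 1) + 1 *s row n (mat 1) else row k (mat 1))"
      by (auto simp: matrix_def vec_eq_iff axis_def row_def mat_def)
    then have "det (matrix ?h) = 1"
      by (simp only: det_row_operation[OF mn] det_I)
    then show "?P ?h"
      using mn by (simp add: h nn_integral_lborel_shear)
  qed
  with assms show ?thesis by blast
qed

text \<open>The change of variables as an identity of measures, with a translation added. In this
  form it applies to Bochner integrals through densities and image measures.\<close>

lemma lborel_linear:
  fixes f :: "real^'n \<Rightarrow> real^'n"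
  assumes "linear f" "det (matrix f) \<noteq> 0"
  shows "lborel = density (distr lborel borel (\<lambda>x. t + f x)) (\<lambda>_. ennreal \<bar>det (matrix f)\<bar>)"
proof (rule measure_eqI)
  have [measurable]: "f \<in> borel_measurable borel"
    using assms(1) by (intro borel_measurable_continuous_onI linear_continuous_on linear_linear[THEN iffD2])
  fix A :: "(real^'n) set" assume "A \<in> sets lborel"
  then have [measurable]: "A \<in> sets borel" by simp
  have "emeasure lborel A = (\<integral>\<^sup>+x. indicator A x \<partial>lborel)" by simp
  also have "\<dots> = (\<integral>\<^sup>+x. indicator A (t + x) \<partial>lborel)"
    by (subst lborel_affine[of 1 t]) (simp_all add: nn_integral_density nn_integral_distr del: nn_integral_indicator)
  also have "\<dots> = ennreal \<bar>det (matrix f)\<bar> * (\<integral>\<^sup>+x. indicator A (t + f x) \<partial>lborel)"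
    by (rule nn_integral_lborel_linear[OF assms]) simp
  also have "\<dots> = emeasure (density (distr lborel borel (\<lambda>x. t + f x)) (\<lambda>_. ennreal \<bar>det (matrix f)\<bar>)) A"
    by (simp add: emeasure_density nn_integral_distr nn_integral_cmult del: nn_integral_indicator)
  finally show "emeasure lborel A = \<dots>" .
qed simp

text \<open>Values in a Banach space are allowed because the integrals of the model are vectors and
  matrices.\<close>

lemma has_bochner_integral_lborel_linear:
  fixes f :: "real^'n \<Rightarrow> real^'n" and g :: "real^'n \<Rightarrow> 'a :: {banach, second_countable_topology}"
  assumes "linear f" "det (matrix f) \<noteq> 0" and [measurable]: "g \<in> borel_measurable borel"
    and int: "has_bochner_integral lborel (\<lambda>x. \<bar>det (matrix f)\<bar> *\<^sub>R g (t + f x)) c"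
  shows "has_bochner_integral lborel g c"
proof -
  have [measurable]: "f \<in> borel_measurable borel"
    using assms(1) by (intro borel_measurable_continuous_onI linear_continuous_on linear_linear[THEN iffD2])
  show ?thesis
    by (subst lborel_linear[OF assms(1,2), of t], rule has_bochner_integral_density)
       (use int in \<open>auto intro!: has_bochner_integral_distr\<close>)
qed

section \<open>Rank-one updates and square roots of matrices\<close>

text \<open>Keeps products in the form \<open>transpose A *v x\<close>; as a simp rule it would turn
  them into \<open>x v* A\<close>.\<close>

declare transpose_matrix_vector [simp del]

lemma outer_mult_vec: "outer u v *v x = (v \<bullet> x) *\<^sub>R u"
  by (simp add: outer_def matrix_vector_mult_def vec_eq_iff inner_vec_def sum_distrib_left mult_ac)

lemma inner_transpose_matrix: "(transpose A *v y) \<bullet> x = (y::real^'n) \<bullet> (A *v x)"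
  by (simp only: transpose_matrix_vector dot_lmul_matrix)

lemma inner_matrix_transpose: "(A *v x) \<bullet> y = x \<bullet> (transpose A *v (y::real^'n))"
  using inner_transpose_matrix[of A y x] by (simp only: inner_commute)

lemma matrix_mult_outer: "A ** outer u v = outer (A *v u) v"
  by (simp add: matrix_eq outer_mult_vec matrix_vector_mul_assoc[symmetric] matrix_vector_mult_scaleR)

lemma outer_mult_matrix: "outer u v ** A = outer u (transpose A *v v)"
  by (simp add: matrix_eq outer_mult_vec matrix_vector_mul_assoc[symmetric] inner_transpose_matrix)

lemma outer_scaleR_left: "outer (c *\<^sub>R u) v = c *\<^sub>R outer u v"
  by (simp add: outer_def vec_eq_iff)

lemma outer_scaleR_right: "outer u (c *\<^sub>R v) = c *\<^sub>R outer u v"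
  by (simp add: outer_def vec_eq_iff)

lemma outer_add_left: "outer (u + w) v = outer u v + outer w v"
  by (simp add: outer_def vec_eq_iff distrib_left distrib_right)

lemma outer_add_right: "outer u (v + w) = outer u v + outer u w"
  by (simp add: outer_def vec_eq_iff distrib_left distrib_right)

lemma matrix_add_rdistrib: "((B::real^'n^'m) + C) ** A = B ** A + C ** A"
  by (simp add: matrix_eq matrix_vector_mul_assoc[symmetric] matrix_vector_mult_add_rdistrib)

text \<open>Rotating \<open>u\<close> onto a coordinate axis changes only one row of the identity.\<close>

lemma det_add_outer_I: "det (mat 1 + outer u v :: real^'n^'n) = 1 + u \<bullet> v"
proof (cases "u = 0")
  case True
  then have "outer u v = 0" by (simp add: outer_def vec_eq_iff)
  then show ?thesis using True by simp
next
  case False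
  \<comment> \<open>Any coordinate serves as the target of the rotation.\<close>
  define k :: 'n where "k = undefined"
  obtain Q :: "real^'n^'n" where Q: "orthogonal_matrix Q" "Q *v axis k 1 = u /\<^sub>R norm u"
    using orthogonal_matrix_exists_basis[of "u /\<^sub>R norm u"] False by (metis norm_sgn sgn_div_norm)
  have QQ: "transpose Q ** Q = mat 1" "Q ** transpose Q = mat 1"
    using Q(1) by (auto simp: orthogonal_matrix_def)
  define w where "w = norm u *\<^sub>R (transpose Q *v v)"
  have u: "u = norm u *\<^sub>R (Q *v axis k 1)"
    using False by (simp add: Q(2))
  have tr: "transpose Q *v u = norm u *\<^sub>R axis k 1"
    by (subst u) (simp add: matrix_vector_mult_scaleR matrix_vector_mul_assoc QQ)
  have "transpose Q ** (mat 1 + outer u v) ** Q = mat 1 + outer (transpose Q *v u) (transpose Q *v v)"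
    by (simp add: matrix_add_ldistrib matrix_add_rdistrib QQ matrix_mult_outer outer_mult_matrix)
  also have "\<dots> = mat 1 + outer (axis k 1) w"
    by (simp add: tr w_def outer_scaleR_left outer_scaleR_right)
  \<comment> \<open>Row \<open>k\<close> is the vector \<open>axis k 1 + w\<close>, written as a
    combination of the rows of the identity to fit \<open>cramer_lemma_transpose\<close>.\<close>
  also have "\<dots> = (\<chi> i. if i = k then \<Sum>i\<in>UNIV. (axis k 1 + w) $ i *s row i (mat 1) else row i (mat 1))"
    by (auto simp: vec_eq_iff outer_def row_def mat_def axis_def if_distrib cong: if_cong)
  also have "det \<dots> = (axis k 1 + w) $ k * det (mat 1 :: real^'n^'n)"
    by (rule cramer_lemma_transpose)
  also have "\<dots> = 1 + w $ k" by (simp add: axis_def)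
  also have "w $ k = u \<bullet> v"
  proof -
    have "w $ k = axis k 1 \<bullet> w" by (simp add: inner_axis' )
    also have "\<dots> = (transpose Q *v u) \<bullet> (transpose Q *v v)"
      by (simp add: w_def tr)
    also have "\<dots> = u \<bullet> v"
      by (simp add: inner_matrix_transpose matrix_vector_mul_assoc QQ)
    finally show ?thesis .
  qed
  finally have "(det Q * det Q) * det (mat 1 + outer u v) = 1 + u \<bullet> v"
    by (simp add: det_mul mult_ac)
  moreover have "det Q * det Q = 1"
    using arg_cong[OF QQ(1), of det] by (simp add: det_mul)
  ultimately show ?thesis by simp
qed

text \<open>The matrix factors as (I + a u u^T)(I + b x v^T), where \<open>x\<close> solves (I + a u
  u^T) x = v, so the rank-one formula applies twice. The bound on \<open>a\<close> keeps the first
  factor invertible.\<close>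

lemma det_add_two_outer_I:
  assumes "a \<ge> 0"
  shows "det (mat 1 + a *\<^sub>R outer u u + b *\<^sub>R outer v v :: real^'n^'n)
    = (1 + a * (u \<bullet> u)) * (1 + b * (v \<bullet> v)) - a * b * (u \<bullet> v)\<^sup>2"
proof -
  have "1 + a * (u \<bullet> u) > 0"
    using assms by (intro add_pos_nonneg) auto
  \<comment> \<open>\<open>c\<close> is the Sherman-Morrison coefficient: I - c u u^T inverts I + a
    u u^T.\<close>
  define c where "c = a / (1 + a * (u \<bullet> u))"
  define x where "x = v - (c * (u \<bullet> v)) *\<^sub>R u"
  have c: "c * (1 + a * (u \<bullet> u)) = a" using \<open>1 + a * (u \<bullet> u) > 0\<close> by (simp add: c_def)
  have "a * (u \<bullet> x) = (a - c * (a * (u \<bullet> u))) * (u \<bullet> v)"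
    by (simp add: x_def inner_simps algebra_simps)
  also have "a - c * (a * (u \<bullet> u)) = c" using c by (simp add: algebra_simps)
  finally have ux: "(u \<bullet> x) * a = c * (u \<bullet> v)" by (simp add: mult.commute)
  have "(mat 1 + outer (a *\<^sub>R u) u) *v x = v"
    by (simp add: matrix_vector_mult_add_rdistrib outer_mult_vec ux) (simp add: x_def)
  then have eq: "(mat 1 + outer (a *\<^sub>R u) u) ** outer (b *\<^sub>R x) v = b *\<^sub>R outer v v"
    by (simp only: matrix_mult_outer matrix_vector_mult_scaleR) (rule outer_scaleR_left)
  have "mat 1 + a *\<^sub>R outer u u + b *\<^sub>R outer v v
      = (mat 1 + outer (a *\<^sub>R u) u) ** (mat 1 + outer (b *\<^sub>R x) v)"
    by (simp only: matrix_add_ldistrib eq matrix_mul_rid) (simp only: outer_scaleR_left)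
  then have "det (mat 1 + a *\<^sub>R outer u u + b *\<^sub>R outer v v) = (1 + a * (u \<bullet> u)) * (1 + b * (x \<bullet> v))"
    by (simp add: det_mul det_add_outer_I)
  also have "x \<bullet> v = v \<bullet> v - c * (u \<bullet> v)\<^sup>2"
    by (simp add: x_def inner_diff_left power2_eq_square)
  also have "(1 + a * (u \<bullet> u)) * (1 + b * (v \<bullet> v - c * (u \<bullet> v)\<^sup>2))
      = (1 + a * (u \<bullet> u)) * (1 + b * (v \<bullet> v)) - c * (1 + a * (u \<bullet> u)) * b * (u \<bullet> v)\<^sup>2"
    by (simp add: algebra_simps)
  finally show ?thesis by (simp add: c)
qed

text \<open>Gram-Schmidt for the inner product x^T S y, starting from the prescribed vector
  \<open>u\<close> at index \<open>k\<close>. The vectors are indexed by coordinates so that they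
  can become the columns of a matrix.\<close>

lemma pos_def_orthonormal_vectors:
  fixes S :: "real^'n^'n" and k :: 'n
  assumes S: "pos_def_mat S" and u: "u \<bullet> (S *v u) = 1" and "finite I" "k \<notin> I"
  shows "\<exists>v. v k = u \<and> (\<forall>i\<in>insert k I. \<forall>j\<in>insert k I. v i \<bullet> (S *v v j) = (if i = j then 1 else 0))"
  using \<open>finite I\<close> \<open>k \<notin> I\<close>
proof (induction I)
  case empty
  then show ?case using u by (intro exI[of _ "\<lambda>_. u"]) auto
next
  case (insert l I)
  then obtain v where v: "v k = u" "\<forall>i\<in>insert k I. \<forall>j\<in>insert k I.
      v i \<bullet> (S *v v j) = (if i = j then 1 else 0)"
    by blast
  have sym: "x \<bullet> (S *v y) = y \<bullet> (S *v x)" for x y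
    using S by (metis pos_def_mat_def inner_matrix_transpose inner_commute)
  \<comment> \<open>S-orthogonality to \<open>v i\<close> is ordinary orthogonality to
    \<open>S *v v i\<close>. As \<open>l\<close> is a further index, these vectors cannot span the
    whole space, so a nonzero orthogonal vector exists.\<close>
  let ?W = "(\<lambda>i. S *v v i) ` insert k I"
  have l: "l \<notin> insert k I" using insert by auto
  have "dim ?W \<le> card ?W"
    using insert(1) by (intro dim_le_card') auto
  also have "\<dots> \<le> card (insert k I)" using insert(1) by (intro card_image_le) auto
  also have "\<dots> < card (insert l (insert k I))" using l insert(1) by simp
  also have "\<dots> \<le> CARD('n)" by (intro card_mono) auto
  finally have "dim ?W < DIM(real^'n)" by simp
  then obtain x where x: "x \<noteq> 0" "\<And>y. y \<in> span ?W \<Longrightarrow> orthogonal x y"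
    using orthogonal_to_subspace_exists by metis
  have xv: "x \<bullet> (S *v v i) = 0" if "i \<in> insert k I" for i
    using x(2)[OF span_base, of "S *v v i"] that by (auto simp: orthogonal_def)
  have q: "x \<bullet> (S *v x) > 0" using S x(1) by (simp add: pos_def_mat_def)
  define y where "y = (1 / sqrt (x \<bullet> (S *v x))) *\<^sub>R x"
  have yv: "y \<bullet> (S *v v i) = 0" "v i \<bullet> (S *v y) = 0" if "i \<in> insert k I" for i
    using xv[OF that] sym[of "v i" x] by (simp_all add: y_def matrix_vector_mult_scaleR)
  have yy: "y \<bullet> (S *v y) = 1"
    using q by (simp add: y_def matrix_vector_mult_scaleR)
  have "k \<noteq> l" using insert by auto
  show ?case
    using v yv yy l by (intro exI[of _ "v(l := y)"]) auto
qed

text \<open>The columns of \<open>V\<close> are an \<open>S\<close>-orthonormal basis extending \<open>b / \<tau>\<close>; then \<open>L = S V\<close> has inverse \<open>V\<^sup>T\<close>.\<close>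

lemma pos_def_square_root:
  fixes S :: "real^'n^'n" and k :: 'n
  assumes S: "pos_def_mat S" and "b \<noteq> 0"
  obtains L where "L ** transpose L = S" "det L \<noteq> 0" "transpose L *v b = sqrt (b \<bullet> (S *v b)) *\<^sub>R axis k 1"
proof -
  define \<tau> where "\<tau> = sqrt (b \<bullet> (S *v b))"
  have q: "b \<bullet> (S *v b) > 0" using assms by (simp add: pos_def_mat_def)
  then have \<tau>: "\<tau> > 0" "\<tau> * \<tau> = b \<bullet> (S *v b)" by (simp_all add: \<tau>_def)
  define u where "u = (1 / \<tau>) *\<^sub>R b"
  have "u \<bullet> (S *v u) = 1"
    using \<tau> q by (simp add: u_def matrix_vector_mult_scaleR flip: \<tau>(2))
  from pos_def_orthonormal_vectors[OF S this, of "UNIV - {k}" k]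
  obtain v where v: "v k = u" "\<And>i j. v i \<bullet> (S *v v j) = (if i = j then 1 else 0)"
    by (auto simp: insert_Diff_if insert_absorb)
  have tS: "transpose S = S" using S by (simp add: pos_def_mat_def)
  define V where "V = (\<chi> i j. v j $ i)"
  have Vax: "V *v axis j 1 = v j" for j
    by (simp add: V_def matrix_vector_mult_basis column_def vec_eq_iff)
  have VSV: "transpose V ** (S ** V) = mat 1"
  proof -
    have "(transpose V ** (S ** V)) $ i $ j = v i \<bullet> (S *v v j)" for i j
    proof -
      have "(transpose V ** (S ** V)) $ i $ j = axis i 1 \<bullet> ((transpose V ** (S ** V)) *v axis j 1)"
        by (simp add: matrix_vector_mult_basis column_def inner_axis')
      also have "\<dots> = v i \<bullet> (S *v v j)"
        by (simp add: matrix_vector_mul_assoc[symmetric] inner_matrix_transpose[symmetric] Vax)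
      finally show ?thesis .
    qed
    then show ?thesis by (simp add: vec_eq_iff v mat_def)
  qed
  then have SVV: "(S ** V) ** transpose V = mat 1"
    by (simp add: matrix_left_right_inverse)
  define L where "L = S ** V"
  have tL: "transpose L = transpose V ** S"
    by (simp add: L_def matrix_transpose_mul tS)
  have 1: "L ** transpose L = S"
    unfolding tL by (simp add: L_def matrix_mul_assoc SVV)
  have b: "b = \<tau> *\<^sub>R (V *v axis k 1)" using \<tau> by (simp add: Vax v u_def)
  have tLV: "transpose L ** V = mat 1"
    using VSV by (simp add: tL matrix_mul_assoc)
  have "transpose L *v b = \<tau> *\<^sub>R ((transpose L ** V) *v axis k 1)"
    by (subst b) (simp add: matrix_vector_mult_scaleR matrix_vector_mul_assoc)
  then have 2: "transpose L *v b = \<tau> *\<^sub>R axis k 1" by (simp add: tLV)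
  have "det L * det V = 1"
    using arg_cong[OF tLV, of det] by (simp add: det_mul)
  then have 3: "det L \<noteq> 0" by auto
  show thesis using that 1 2 3 unfolding \<tau>_def by blast
qed

section \<open>Expansions of outer products and matrix inverses\<close>

lemma outer_combination:
  "outer (p *\<^sub>R x + q *\<^sub>R y) (p *\<^sub>R x + q *\<^sub>R y)
    = p\<^sup>2 *\<^sub>R outer x x + (p * q) *\<^sub>R (outer x y + outer y x) + q\<^sup>2 *\<^sub>R outer y y"
  by (simp add: outer_def vec_eq_iff algebra_simps power2_eq_square)

text \<open>Separates scalar monomials from constant matrices, so that a matrix-valued integral can
  be evaluated termwise from moments.\<close>

lemma outer_matrix_vector_mult:
  "outer (A *v x) (A *v x) = (\<Sum>i\<in>UNIV. \<Sum>j\<in>UNIV. (x $ i * x $ j) *\<^sub>R outer (column i A) (column j A))"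
  by (simp add: outer_def vec_eq_iff matrix_vector_mult_def column_def sum_product mult_ac)

lemma sum_outer_column: "(\<Sum>i\<in>UNIV. outer (column i A) (column i A)) = A ** transpose A"
  by (simp add: outer_def vec_eq_iff matrix_matrix_mult_def column_def transpose_def)

text \<open>\<open>matrix_inv\<close> is a choice among two-sided inverses; a right inverse of a
  square matrix is two-sided and unique.\<close>

lemma matrix_inv_eqI:
  fixes A B :: "real^'n^'n"
  assumes "A ** B = mat 1"
  shows "matrix_inv A = B"
proof -
  have BA: "B ** A = mat 1" using assms by (simp add: matrix_left_right_inverse)
  have "A ** matrix_inv A = mat 1"
    unfolding matrix_inv_def by (rule someI2[of _ B]) (use assms BA in auto)
  then have "B ** (A ** matrix_inv A) = B" by simp
  then show ?thesis by (simp add: matrix_mul_assoc BA)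
qed

text \<open>The inverse of \<open>S\<close> is L^-T L^-1, so the Mahalanobis inner product becomes
  the Euclidean one in whitened coordinates.\<close>

lemma inner_matrix_inv:
  fixes L S :: "real^'n^'n"
  assumes S: "L ** transpose L = S" and L: "det L \<noteq> 0"
  shows "(L *v x) \<bullet> (matrix_inv S *v (L *v y)) = x \<bullet> y"
proof -
  obtain L' where L': "L ** L' = mat 1" "L' ** L = mat 1"
    using L by (metis invertible_def invertible_det_nz)
  have "S ** (transpose L' ** L') = L ** transpose (L' ** L) ** L'"
    by (simp add: S[symmetric] matrix_mul_assoc matrix_transpose_mul)
  then have "matrix_inv S = transpose L' ** L'"
    by (intro matrix_inv_eqI) (simp add: L' transpose_mat)
  then have "(L *v x) \<bullet> (matrix_inv S *v (L *v y)) = (L' *v (L *v x)) \<bullet> (L' *v (L *v y))"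
    by (simp add: matrix_vector_mul_assoc[symmetric] inner_matrix_transpose)
  then show ?thesis
    by (simp add: matrix_vector_mul_assoc L')
qed

lemma det_matrix_inv:
  fixes A :: "real^'n^'n"
  assumes "det A \<noteq> 0"
  shows "det (matrix_inv A) = inverse (det A)"
proof -
  have "invertible A" using assms by (simp add: invertible_det_nz)
  then obtain B where B: "A ** B = mat 1"
    unfolding invertible_def by blast
  then have "det (A ** B) = 1" by simp
  then have "det A * det B = 1" by (simp only: det_mul)
  then have "inverse (det A) = det B" by (rule inverse_unique)
  then show ?thesis by (simp only: matrix_inv_eqI[OF B])
qed

section \<open>Gaussian integrals\<close>

text \<open>Fubini for the product over \<open>Basis\<close> that underlies \<open>lborel\<close>;
  the work lies in passing between basis vectors and coordinate indices.\<close>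

lemma has_bochner_integral_prod_cart:
  fixes g :: "'n::finite \<Rightarrow> real \<Rightarrow> real"
  assumes g: "\<And>i. has_bochner_integral lborel (g i) (c i)"
  shows "has_bochner_integral lborel (\<lambda>z::real^'n. \<Prod>i\<in>UNIV. g i (z $ i)) (\<Prod>i\<in>UNIV. c i)"
proof -
  interpret product_sigma_finite "\<lambda>_::real^'n. lborel :: real measure" ..
  let ?B = "Basis :: (real^'n) set"
  define ix where "ix b = (THE i. b = axis i (1::real))" for b :: "real^'n"
  have ix: "ix (axis i 1) = i" for i
    by (auto simp: ix_def axis_eq_axis)
  have int: "integrable lborel (g i)" "integral\<^sup>L lborel (g i) = c i" for i
    using g by (auto simp: has_bochner_integral_iff)
  have [measurable]: "g i \<in> borel_measurable borel" for i
    using borel_measurable_integrable[OF int(1)[of i]] by simp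
  let ?v = "\<lambda>f. \<Sum>b\<in>?B. f b *\<^sub>R b"
  have v: "(\<Prod>i\<in>UNIV. g i (?v f $ i)) = (\<Prod>b\<in>?B. g (ix b) (f b))" for f
  proof -
    have "?v f $ i = f (axis i 1)" for i
    proof -
      have "?v f $ i = ?v f \<bullet> axis i 1" by (simp add: inner_axis)
      also have "\<dots> = f (axis i 1)"
        by (simp add: axis_in_Basis_iff inner_sum_left inner_Basis if_distrib cong: if_cong)
      finally show ?thesis .
    qed
    then show ?thesis by (simp add: prod_Basis_cart ix)
  qed
  have "has_bochner_integral (\<Pi>\<^sub>M b\<in>?B. lborel) (\<lambda>f. \<Prod>b\<in>?B. g (ix b) (f b)) (\<Prod>b\<in>?B. c (ix b))"
    unfolding has_bochner_integral_iff
    using product_integrable_prod[of ?B "\<lambda>b. g (ix b)"] product_integral_prod[of ?B "\<lambda>b. g (ix b)"] int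
    by auto
  then have "has_bochner_integral (\<Pi>\<^sub>M b\<in>?B. lborel) (\<lambda>f. \<Prod>i\<in>UNIV. g i (?v f $ i)) (\<Prod>i\<in>UNIV. c i)"
    unfolding v by (simp only: prod_Basis_cart ix)
  then show ?thesis
    by (subst lborel_eq, intro has_bochner_integral_distr) (auto simp del: sum_component)
qed

text \<open>The product form lets integrals against it be computed one coordinate at a time.\<close>

definition std_normal_vec :: "real^'n \<Rightarrow> real" where
  "std_normal_vec z = (\<Prod>i\<in>UNIV. std_normal_density (z $ i))"

lemma has_bochner_integral_std_normal_density: "has_bochner_integral lborel std_normal_density 1"
  using normal_moment_even[of 1 0 0] by simp

text \<open>All coordinates other than \<open>k\<close> contribute the total mass 1.\<close>

lemma std_normal_vec_marginal:
  assumes "has_bochner_integral lborel (\<lambda>t. std_normal_density t * F t) c"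
  shows "has_bochner_integral lborel (\<lambda>z::real^'n. std_normal_vec z * F (z $ k)) c"
proof -
  let ?g = "\<lambda>i t. std_normal_density t * (if i = k then F t else 1)"
  have "has_bochner_integral lborel (?g i) (if i = k then c else 1)" for i
    using assms has_bochner_integral_std_normal_density by (auto simp del: mult_1_right) simp
  from has_bochner_integral_prod_cart[of ?g, OF this]
  show ?thesis
    by (simp add: std_normal_vec_def prod.distrib)
qed

text \<open>Distinct coordinates are independent, so the expectation of the product
  factorises.\<close>

lemma std_normal_vec_pair:
  assumes "has_bochner_integral lborel (\<lambda>t. std_normal_density t * F t) c"
    and "has_bochner_integral lborel (\<lambda>t. std_normal_density t * G t) d"
    and "j \<noteq> k"
  shows "has_bochner_integral lborel (\<lambda>z::real^'n. std_normal_vec z * (F (z $ k) * G (z $ j))) (c * d)"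
proof -
  let ?g = "\<lambda>i t. std_normal_density t * ((if i = k then F t else 1) * (if i = j then G t else 1))"
  have "has_bochner_integral lborel (?g i) ((if i = k then c else 1) * (if i = j then d else 1))" for i
    using assms has_bochner_integral_std_normal_density by auto
  from has_bochner_integral_prod_cart[of ?g, OF this]
  show ?thesis
    by (simp add: std_normal_vec_def prod.distrib)
qed

text \<open>The central moments of order 0 to 4 are 1, 0, \<sigma>^2, 0, 3 \<sigma>^4. Degree four
  is what the squares of the quadratic coefficients in \<Gamma>1 and \<Gamma>2 require.\<close>

lemma normal_moment_poly:
  assumes "\<sigma> > 0"
  shows "has_bochner_integral lborel (\<lambda>x. normal_density \<mu> \<sigma> x *
      (a0 + a1 * (x - \<mu>) + a2 * (x - \<mu>)^2 + a3 * (x - \<mu>)^3 + a4 * (x - \<mu>)^4))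
    (a0 + a2 * \<sigma>\<^sup>2 + 3 * a4 * \<sigma>^4)"
proof -
  note even = normal_moment_even[OF assms, of \<mu>] and odd = normal_moment_odd[OF assms, of \<mu>]
  have "has_bochner_integral lborel (\<lambda>x.
        normal_density \<mu> \<sigma> x * (x - \<mu>)^(2*0) * a0
      + normal_density \<mu> \<sigma> x * (x - \<mu>)^(2*0+1) * a1
      + normal_density \<mu> \<sigma> x * (x - \<mu>)^(2*1) * a2
      + normal_density \<mu> \<sigma> x * (x - \<mu>)^(2*1+1) * a3
      + normal_density \<mu> \<sigma> x * (x - \<mu>)^(2*2) * a4)
    (fact (2 * 0) / ((2 / \<sigma>\<^sup>2)^0 * fact 0) * a0 + 0 * a1
      + fact (2 * 1) / ((2 / \<sigma>\<^sup>2)^1 * fact 1) * a2 + 0 * a3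
      + fact (2 * 2) / ((2 / \<sigma>\<^sup>2)^2 * fact 2) * a4)"
    by (intro has_bochner_integral_add has_bochner_integral_mult_left even odd)
  also have "(fact (2 * 0) / ((2 / \<sigma>\<^sup>2)^0 * fact 0) * a0 + 0 * a1
      + fact (2 * 1) / ((2 / \<sigma>\<^sup>2)^1 * fact 1) * a2 + 0 * a3
      + fact (2 * 2) / ((2 / \<sigma>\<^sup>2)^2 * fact 2) * a4) = a0 + a2 * \<sigma>\<^sup>2 + 3 * a4 * \<sigma>^4"
    using assms by (simp add: fact_numeral field_simps)
  finally show ?thesis by (simp add: algebra_simps eval_nat_numeral)
qed

lemma std_normal_moment_poly:
  "has_bochner_integral lborel (\<lambda>x. std_normal_density x *
      (a0 + a1 * x + a2 * x^2 + a3 * x^3 + a4 * x^4)) (a0 + a2 + 3 * a4)"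
  using normal_moment_poly[of 1 0 a0 a1 a2 a3 a4] by simp

lemma normal_density_shift: "normal_density 0 c (y - m) = normal_density m c y"
  by (simp add: normal_density_def)

text \<open>The joint density of \<open>(\<tau> Z + \<epsilon>, Z)\<close> factors as the marginal of the sum times the
  conditional density of \<open>Z\<close>.\<close>

lemma normal_density_mult_std:
  fixes \<sigma> \<tau> u t :: real
  assumes "\<sigma> > 0"
  defines "s \<equiv> sqrt (\<tau>\<^sup>2 + \<sigma>\<^sup>2)"
  shows "normal_density 0 \<sigma> (u - \<tau> * t) * std_normal_density t
    = normal_density 0 s u * normal_density (\<tau> * u / s\<^sup>2) (\<sigma> / s) t"
proof -
  have s: "s > 0" "s\<^sup>2 = \<tau>\<^sup>2 + \<sigma>\<^sup>2"
    using assms by (auto simp: s_def intro!: add_nonneg_pos)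
  \<comment> \<open>Completing the square in \<open>t\<close>: both sides are compared over the
    common denominator 2 \<sigma>^2 s^2.\<close>
  have e: "- ((u - \<tau> * t)\<^sup>2 / (2 * \<sigma>\<^sup>2)) - t\<^sup>2 / 2
     = - (u\<^sup>2 / (2 * s\<^sup>2)) - (t - \<tau> * u / s\<^sup>2)\<^sup>2 / (2 * (\<sigma> / s)\<^sup>2)"
  proof -
    have "(t - \<tau> * u / s\<^sup>2)\<^sup>2 / (2 * (\<sigma> / s)\<^sup>2) = (t * s\<^sup>2 - \<tau> * u)\<^sup>2 / (2 * \<sigma>\<^sup>2 * s\<^sup>2)"
      using s(1) assms(1) by (simp add: field_simps power2_eq_square)
    moreover have "(u - \<tau> * t)\<^sup>2 / (2 * \<sigma>\<^sup>2) + t\<^sup>2 / 2 = ((u - \<tau> * t)\<^sup>2 + t\<^sup>2 * \<sigma>\<^sup>2) * s\<^sup>2 / (2 * \<sigma>\<^sup>2 * s\<^sup>2)"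
      using s(1) assms(1) by (simp add: field_simps)
    moreover have "u\<^sup>2 / (2 * s\<^sup>2) = u\<^sup>2 * \<sigma>\<^sup>2 / (2 * \<sigma>\<^sup>2 * s\<^sup>2)"
      using s(1) assms(1) by (simp add: field_simps)
    moreover have "((u - \<tau> * t)\<^sup>2 + t\<^sup>2 * \<sigma>\<^sup>2) * s\<^sup>2 = u\<^sup>2 * \<sigma>\<^sup>2 + (t * s\<^sup>2 - \<tau> * u)\<^sup>2"
      unfolding s(2) by algebra
    ultimately show ?thesis by (simp add: add_divide_distrib)
  qed
  have c: "sqrt (2 * pi * \<sigma>\<^sup>2) * sqrt (2 * pi) = sqrt (2 * pi * s\<^sup>2) * sqrt (2 * pi * (\<sigma> / s)\<^sup>2)"
    using s(1) assms(1) by (simp add: real_sqrt_mult[symmetric] power_divide)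
  have "normal_density 0 \<sigma> (u - \<tau> * t) * std_normal_density t
     = exp (- ((u - \<tau> * t)\<^sup>2 / (2 * \<sigma>\<^sup>2)) - t\<^sup>2 / 2) / (sqrt (2 * pi * \<sigma>\<^sup>2) * sqrt (2 * pi))"
    by (simp add: normal_density_def exp_add[symmetric])
  also have "\<dots> = normal_density 0 s u * normal_density (\<tau> * u / s\<^sup>2) (\<sigma> / s) t"
    unfolding e c by (simp add: normal_density_def exp_add[symmetric])
  finally show ?thesis .
qed

section \<open>Noise score, Fisher information and the multivariate normal density\<close>

lemma fprime_eq:
  assumes "\<sigma> > 0"
  shows "fprime \<sigma> t = - (t / \<sigma>\<^sup>2) * normal_density 0 \<sigma> t"
proof -
  have "((\<lambda>t. c * exp (- (t - 0)\<^sup>2 / (2 * \<sigma>\<^sup>2))) has_real_derivative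
      - (t / \<sigma>\<^sup>2) * (c * exp (- (t - 0)\<^sup>2 / (2 * \<sigma>\<^sup>2)))) (at t)" for c
    using assms by (auto intro!: derivative_eq_intros simp: field_simps)
  then show ?thesis
    unfolding fprime_def normal_density_def[abs_def] by (rule DERIV_imp_deriv)
qed

text \<open>The integrand is t^2 / \<sigma>^4 times the density, so the value is the variance
  divided by \<sigma>^4.\<close>

lemma integral_fisher_information:
  assumes "\<sigma> > 0"
  shows "(LINT t|lborel. (fprime \<sigma> t)\<^sup>2 / normal_density 0 \<sigma> t) = 1 / \<sigma>\<^sup>2"
proof -
  have "(fprime \<sigma> t)\<^sup>2 / normal_density 0 \<sigma> t = normal_density 0 \<sigma> t *
      (0 + 0 * (t - 0) + 1 / \<sigma>^4 * (t - 0)^2 + 0 * (t - 0)^3 + 0 * (t - 0)^4)" for t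
    using normal_density_pos[OF assms, of 0 t]
    by (simp add: fprime_eq[OF assms] power2_eq_square field_simps power4_eq_xxxx)
  then have "has_bochner_integral lborel (\<lambda>t. (fprime \<sigma> t)\<^sup>2 / normal_density 0 \<sigma> t)
       (0 + 1 / \<sigma>^4 * \<sigma>\<^sup>2 + 3 * 0 * \<sigma>^4)"
    by (simp only: normal_moment_poly[OF assms])
  then show ?thesis
    by (simp add: has_bochner_integral_integral_eq power2_eq_square power4_eq_xxxx)
qed

text \<open>Since det S = (det L)^2, the Jacobian cancels the determinant in the normalising
  constant.\<close>

lemma mvn_density_linear:
  fixes L S :: "real^'n^'n"
  assumes S: "L ** transpose L = S" and L: "det L \<noteq> 0"
  shows "\<bar>det L\<bar> * mvn_density \<mu> S (\<mu> + L *v z) = std_normal_vec z"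
proof -
  have "det S = (det L)\<^sup>2" by (simp add: S[symmetric] det_mul power2_eq_square)
  then have "mvn_density \<mu> S (\<mu> + L *v z) = exp (- (z \<bullet> z) / 2) / (sqrt ((2 * pi) ^ CARD('n)) * \<bar>det L\<bar>)"
    by (simp add: mvn_density_def inner_matrix_inv[OF S L] real_sqrt_mult)
  moreover have "std_normal_vec z = exp (- (z \<bullet> z) / 2) / sqrt ((2 * pi) ^ CARD('n))"
    unfolding real_sqrt_power
    by (simp add: std_normal_vec_def normal_density_def prod_dividef exp_sum[symmetric] inner_vec_def
        sum_negf sum_divide_distrib[symmetric] power2_eq_square power_one_over)
  ultimately show ?thesis using L by simp
qed

lemma borel_measurable_matrix_mult [measurable]:
  "(\<lambda>x. A *v x) \<in> borel_measurable borel" for A :: "real^'n^'m"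
  by (intro borel_measurable_continuous_onI linear_continuous_on linear_linear[THEN iffD2]) simp

lemma borel_measurable_mvn_density [measurable]: "mvn_density \<mu> S \<in> borel_measurable borel"
  unfolding mvn_density_def[abs_def] by measurable

text \<open>Whitening: expectations under N(\<mu>, S) are computed from a standard normal
  vector.\<close>

lemma has_bochner_integral_mvn_density:
  fixes L S :: "real^'n^'n" and g :: "real^'n \<Rightarrow> 'a :: {banach, second_countable_topology}"
  assumes S: "L ** transpose L = S" and L: "det L \<noteq> 0" and g[measurable]: "g \<in> borel_measurable borel"
    and int: "has_bochner_integral lborel (\<lambda>z. std_normal_vec z *\<^sub>R g (\<mu> + L *v z)) c"
  shows "has_bochner_integral lborel (\<lambda>x. mvn_density \<mu> S x *\<^sub>R g x) c"
proof (rule has_bochner_integral_lborel_linear[of "(*v) L" _ \<mu>])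
  have "\<bar>det L\<bar> *\<^sub>R mvn_density \<mu> S (\<mu> + L *v z) *\<^sub>R g (\<mu> + L *v z) = std_normal_vec z *\<^sub>R g (\<mu> + L *v z)" for z
    by (simp add: mvn_density_linear[OF S L])
  then show "has_bochner_integral lborel (\<lambda>z. \<bar>det (matrix ((*v) L))\<bar> *\<^sub>R
      mvn_density \<mu> S (\<mu> + L *v z) *\<^sub>R g (\<mu> + L *v z)) c"
    using int by (simp only: matrix_of_matrix_vector_mul)
qed (use L in simp_all)

section \<open>The Gaussian linear model in whitened coordinates\<close>

text \<open>\<open>L\<close> is a square root of \<open>S\<close> rotated so that \<open>\<beta>\<close> only sees the coordinate \<open>k\<close>:
  for \<open>x = \<mu> + L z\<close> one has \<open>\<beta> \<bullet> x = \<beta> \<bullet> \<mu> + \<tau> z\<^sub>k\<close>.\<close>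

locale gaussian_model =
  fixes \<sigma> \<tau> :: real and \<beta> \<mu> :: "real^'n" and S L :: "real^'n^'n" and k :: 'n
  assumes \<sigma>: "\<sigma> > 0" and \<tau>: "\<tau> > 0"
    and LL: "L ** transpose L = S" and detL: "det L \<noteq> 0"
    and L\<beta>: "transpose L *v \<beta> = \<tau> *\<^sub>R axis k 1"
begin

text \<open>The standard deviation of the response Y; the vector \<open>v\<close> introduced next is
  the covariance of X with Y.\<close>

definition "s = sqrt (\<tau>\<^sup>2 + \<sigma>\<^sup>2)"

definition "v = S *v \<beta>"

lemma s: "s > 0" "s\<^sup>2 = \<tau>\<^sup>2 + \<sigma>\<^sup>2"
  using \<sigma> by (auto simp: s_def intro!: add_nonneg_pos)

lemma v_eq: "v = \<tau> *\<^sub>R column k L"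
proof -
  have "v = L *v (transpose L *v \<beta>)"
    unfolding v_def by (subst LL[symmetric]) (simp add: matrix_vector_mul_assoc)
  then show ?thesis by (simp add: L\<beta> matrix_vector_mult_scaleR matrix_vector_mult_basis)
qed

lemma \<beta>_inner: "\<beta> \<bullet> (\<mu> + L *v z) = \<beta> \<bullet> \<mu> + \<tau> * z $ k"
proof -
  have "\<beta> \<bullet> (L *v z) = \<tau> * (axis k 1 \<bullet> z)"
    by (simp add: inner_transpose_matrix[symmetric] L\<beta>)
  then show ?thesis by (simp add: inner_add_right inner_axis')
qed

text \<open>Given Y - \<beta> \<bullet> \<mu> = u, the coordinate \<open>z $ k\<close> is normal
  with mean \<tau> u / s^2 and variance \<sigma>^2 / s^2; the factor in front is the density of that
  condition.\<close>

lemma conditional_moments: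
  "has_bochner_integral lborel (\<lambda>t. std_normal_density t * (normal_density 0 \<sigma> (u - \<tau> * t) * (a + b * t + c * t\<^sup>2)))
    (normal_density 0 s u * (a + b * (\<tau> * u / s\<^sup>2) + c * ((\<tau> * u / s\<^sup>2)\<^sup>2 + (\<sigma> / s)\<^sup>2)))"
proof -
  let ?m = "\<tau> * u / s\<^sup>2"
  have "\<sigma> / s > 0" using \<sigma> s by simp
  \<comment> \<open>The quadratic is expanded about the conditional mean \<open>?m\<close>, because
    the moment formula uses central powers.\<close>
  note moments = normal_moment_poly[OF this, of ?m "a + b * ?m + c * ?m\<^sup>2" "b + 2 * c * ?m" c 0 0]
  have "a + b * m + c * m\<^sup>2 + (b + 2 * c * m) * (t - m) + c * (t - m)^2 + 0 * (t - m)^3 + 0 * (t - m)^4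
      = a + b * t + c * t\<^sup>2" for t m :: real
    by (simp add: algebra_simps power2_eq_square)
  note moments = moments[unfolded this]
  have "a + b * ?m + c * ?m\<^sup>2 + c * (\<sigma> / s)\<^sup>2 + 3 * 0 * (\<sigma> / s)^4 = a + b * ?m + c * (?m\<^sup>2 + (\<sigma> / s)\<^sup>2)"
    by (simp add: algebra_simps)
  note moments = moments[unfolded this]
  have "has_bochner_integral lborel (\<lambda>t. normal_density 0 s u * (normal_density ?m (\<sigma> / s) t * (a + b * t + c * t\<^sup>2)))
     (normal_density 0 s u * (a + b * ?m + c * (?m\<^sup>2 + (\<sigma> / s)\<^sup>2)))"
    by (rule has_bochner_integral_mult_right[OF moments])
  moreover have "std_normal_density t * (normal_density 0 \<sigma> (u - \<tau> * t) * p)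
     = normal_density 0 s u * (normal_density ?m (\<sigma> / s) t * p)" for t p
  proof -
    have "std_normal_density t * (normal_density 0 \<sigma> (u - \<tau> * t) * p)
        = (normal_density 0 \<sigma> (u - \<tau> * t) * std_normal_density t) * p"
      by simp
    also have "\<dots> = normal_density 0 s u * (normal_density ?m (\<sigma> / s) t * p)"
      unfolding s_def by (simp only: normal_density_mult_std[OF \<sigma>] mult.assoc)
    finally show ?thesis .
  qed
  ultimately show ?thesis by (simp only:)
qed

lemma fY_eq: "fY \<sigma> \<beta> \<mu> S y = normal_density 0 s (y - \<beta> \<bullet> \<mu>)"
proof -
  let ?u = "y - \<beta> \<bullet> \<mu>"
  have "has_bochner_integral lborel (\<lambda>z. std_normal_vec z *\<^sub>R normal_density 0 \<sigma> (?u - \<tau> * z $ k)) (normal_density 0 s ?u)"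
    using std_normal_vec_marginal[OF conditional_moments[of ?u 1 0 0], of k] by simp
  then have "has_bochner_integral lborel (\<lambda>x. mvn_density \<mu> S x *\<^sub>R normal_density 0 \<sigma> (y - \<beta> \<bullet> x)) (normal_density 0 s ?u)"
    by (intro has_bochner_integral_mvn_density[OF LL detL]) (simp_all add: \<beta>_inner diff_diff_eq)
  then show ?thesis
    by (simp add: fY_def has_bochner_integral_integral_eq mult.commute)
qed

text \<open>The derivative of the noise density is a linear factor times the density, so conditional
  moments of \<open>z $ k\<close> up to order two suffice. The other coordinates are independent of
  it with mean zero; only column \<open>k\<close> of \<open>L\<close> survives, and it is
  proportional to \<open>v\<close>.\<close>

lemma Avec_eq:
  fixes y defines "u \<equiv> y - \<beta> \<bullet> \<mu>"
  shows "Avec \<sigma> \<beta> \<mu> S y = normal_density 0 s u *\<^sub>R ((- (u / s\<^sup>2)) *\<^sub>R \<mu> + (- (u\<^sup>2 / s^4 - 1 / s\<^sup>2)) *\<^sub>R v)"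
proof -
  let ?f = "\<lambda>t. normal_density 0 \<sigma> (u - \<tau> * t)" and ?h = "normal_density 0 s u"
  let ?p = "- (u / s\<^sup>2)" and ?q = "- (u\<^sup>2 / s^4 - 1 / s\<^sup>2)"
  \<comment> \<open>Here and in \<open>fpt\<close> the integrand takes the shape a + b t + c t^2 of
    \<open>conditional_moments\<close>.\<close>
  have fp: "fprime \<sigma> (u - \<tau> * t) = ?f t * (- u / \<sigma>\<^sup>2 + \<tau> / \<sigma>\<^sup>2 * t + 0 * t\<^sup>2)" for t
    by (simp add: fprime_eq[OF \<sigma>] diff_divide_distrib algebra_simps)
  have fpt: "fprime \<sigma> (u - \<tau> * t) * t = ?f t * (0 + - u / \<sigma>\<^sup>2 * t + \<tau> / \<sigma>\<^sup>2 * t\<^sup>2)" for t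
    by (simp add: fprime_eq[OF \<sigma>] diff_divide_distrib algebra_simps power2_eq_square)
  have 0: "has_bochner_integral lborel (\<lambda>t. std_normal_density t * fprime \<sigma> (u - \<tau> * t)) (?h * ?p)"
  proof -
    have "- u / \<sigma>\<^sup>2 + \<tau> / \<sigma>\<^sup>2 * (\<tau> * u / s\<^sup>2) + 0 * ((\<tau> * u / s\<^sup>2)\<^sup>2 + (\<sigma> / s)\<^sup>2) = ?p"
    proof -
      have "- u / \<sigma>\<^sup>2 + \<tau> / \<sigma>\<^sup>2 * (\<tau> * u / s\<^sup>2) = u * (\<tau>\<^sup>2 - s\<^sup>2) / (\<sigma>\<^sup>2 * s\<^sup>2)"
        using s(1) \<sigma> by (simp add: field_simps power2_eq_square)
      also have "\<dots> = ?p" using \<sigma> by (simp add: s(2))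
      finally show ?thesis by simp
    qed
    from conditional_moments[of u "- u / \<sigma>\<^sup>2" "\<tau> / \<sigma>\<^sup>2" 0, unfolded this]
    show ?thesis unfolding fp .
  qed
  have 1: "has_bochner_integral lborel (\<lambda>t. std_normal_density t * (fprime \<sigma> (u - \<tau> * t) * t)) (?h * (\<tau> * ?q))"
  proof -
    have "0 + - u / \<sigma>\<^sup>2 * (\<tau> * u / s\<^sup>2) + \<tau> / \<sigma>\<^sup>2 * ((\<tau> * u / s\<^sup>2)\<^sup>2 + (\<sigma> / s)\<^sup>2) = \<tau> * ?q"
    proof -
      have "0 + - u / \<sigma>\<^sup>2 * (\<tau> * u / s\<^sup>2) + \<tau> / \<sigma>\<^sup>2 * ((\<tau> * u / s\<^sup>2)\<^sup>2 + (\<sigma> / s)\<^sup>2)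
         = \<tau> * (u\<^sup>2 * (\<tau>\<^sup>2 - s\<^sup>2) + \<sigma>\<^sup>2 * s\<^sup>2) / (\<sigma>\<^sup>2 * s^4)"
        using s(1) \<sigma> by (simp add: field_simps power2_eq_square power4_eq_xxxx)
      also have "u\<^sup>2 * (\<tau>\<^sup>2 - s\<^sup>2) + \<sigma>\<^sup>2 * s\<^sup>2 = \<sigma>\<^sup>2 * (s\<^sup>2 - u\<^sup>2)"
        by (simp add: s(2) algebra_simps)
      also have "\<tau> * (\<sigma>\<^sup>2 * (s\<^sup>2 - u\<^sup>2)) / (\<sigma>\<^sup>2 * s^4) = \<tau> * ?q"
        using s(1) \<sigma> by (simp add: field_simps power2_eq_square power4_eq_xxxx)
      finally show ?thesis .
    qed
    from conditional_moments[of u 0 "- u / \<sigma>\<^sup>2" "\<tau> / \<sigma>\<^sup>2", unfolded this]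
    show ?thesis unfolding fpt .
  qed
  have 2: "has_bochner_integral lborel (\<lambda>z. std_normal_vec z * (fprime \<sigma> (u - \<tau> * z $ k) * z $ j))
      (if j = k then ?h * (\<tau> * ?q) else 0)" for j
  proof (cases "j = k")
    case True
    then show ?thesis using std_normal_vec_marginal[OF 1, of k] by simp
  next
    case False
    have "has_bochner_integral lborel (\<lambda>t. std_normal_density t * t) 0"
      using std_normal_moment_poly[of 0 1 0 0 0] by simp
    from std_normal_vec_pair[OF 0 this False] False show ?thesis by simp
  qed
  have "has_bochner_integral lborel (\<lambda>z. (std_normal_vec z * fprime \<sigma> (u - \<tau> * z $ k)) *\<^sub>R \<mu>
     + (\<Sum>j\<in>UNIV. (std_normal_vec z * (fprime \<sigma> (u - \<tau> * z $ k) * z $ j)) *\<^sub>R column j L))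
     ((?h * ?p) *\<^sub>R \<mu> + (\<Sum>j\<in>UNIV. (if j = k then ?h * (\<tau> * ?q) else 0) *\<^sub>R column j L))"
    by (intro has_bochner_integral_add has_bochner_integral_sum has_bochner_integral_scaleR_left 2
        std_normal_vec_marginal[OF 0])
  also have "(\<lambda>z. (std_normal_vec z * fprime \<sigma> (u - \<tau> * z $ k)) *\<^sub>R \<mu>
     + (\<Sum>j\<in>UNIV. (std_normal_vec z * (fprime \<sigma> (u - \<tau> * z $ k) * z $ j)) *\<^sub>R column j L))
     = (\<lambda>z. std_normal_vec z *\<^sub>R (fprime \<sigma> (u - \<tau> * z $ k) *\<^sub>R (\<mu> + L *v z)))"
    by (simp add: matrix_mult_sum scalar_mult_eq_scaleR scaleR_add_right scaleR_sum_right)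
  also have "(?h * ?p) *\<^sub>R \<mu> + (\<Sum>j\<in>UNIV. (if j = k then ?h * (\<tau> * ?q) else 0) *\<^sub>R column j L)
     = ?h *\<^sub>R (?p *\<^sub>R \<mu> + ?q *\<^sub>R v)"
    by (simp add: v_eq scaleR_add_right scaleR_diff_right if_distrib[of "\<lambda>x. x *\<^sub>R _"] mult_ac cong: if_cong)
  finally have "has_bochner_integral lborel (\<lambda>x. mvn_density \<mu> S x *\<^sub>R (fprime \<sigma> (y - \<beta> \<bullet> x) *\<^sub>R x))
      (?h *\<^sub>R (?p *\<^sub>R \<mu> + ?q *\<^sub>R v))"
    by (intro has_bochner_integral_mvn_density[OF LL detL])
       (simp_all add: \<beta>_inner diff_diff_eq u_def fprime_eq[OF \<sigma>])
  then show ?thesis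
    by (simp add: Avec_def has_bochner_integral_integral_eq mult.commute)
qed

text \<open>Dividing by \<open>fY\<close> leaves one factor of the density of Y, so the entries are
  expectations of products of the coefficients \<open>?p\<close> and \<open>?q\<close>. The mixed
  one is an odd polynomial in the centred response, so the cross terms vanish.\<close>

lemma Gamma1_eq: "Gamma1 \<sigma> \<beta> \<mu> S = (1 / s\<^sup>2) *\<^sub>R outer \<mu> \<mu> + (2 / s^4) *\<^sub>R outer v v"
proof -
  let ?u = "\<lambda>y. y - \<beta> \<bullet> \<mu>" and ?h = "normal_density (\<beta> \<bullet> \<mu>) s"
  let ?p = "\<lambda>y. - (?u y / s\<^sup>2)" and ?q = "\<lambda>y. - ((?u y)\<^sup>2 / s^4 - 1 / s\<^sup>2)"
  have pp: "has_bochner_integral lborel (\<lambda>y. ?h y * (?p y)\<^sup>2) (1 / s\<^sup>2)"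
  proof -
    have "0 + 0 * ?u y + (1 / s^4) * (?u y)^2 + 0 * (?u y)^3 + 0 * (?u y)^4 = (?p y)\<^sup>2" for y
      by (simp add: power_divide)
    moreover have "0 + (1 / s^4) * s\<^sup>2 + 3 * 0 * s^4 = 1 / s\<^sup>2"
      using s(1) by (simp add: power2_eq_square power4_eq_xxxx)
    ultimately show ?thesis
      using normal_moment_poly[OF s(1), of "\<beta> \<bullet> \<mu>" 0 0 "1 / s^4" 0 0] by (simp only:)
  qed
  have pq: "has_bochner_integral lborel (\<lambda>y. ?h y * (?p y * ?q y)) 0"
  proof -
    have "0 + (- 1 / s^4) * ?u y + 0 * (?u y)^2 + (1 / s^6) * (?u y)^3 + 0 * (?u y)^4 = ?p y * ?q y" for y
      using s(1) by (simp add: field_simps eval_nat_numeral)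
    moreover have "0 + 0 * s\<^sup>2 + 3 * 0 * s^4 = 0" by simp
    ultimately show ?thesis
      using normal_moment_poly[OF s(1), of "\<beta> \<bullet> \<mu>" 0 "- 1 / s^4" 0 "1 / s^6" 0] by (simp only:)
  qed
  have qq: "has_bochner_integral lborel (\<lambda>y. ?h y * (?q y)\<^sup>2) (2 / s^4)"
  proof -
    have "1 / s^4 + 0 * ?u y + (- 2 / s^6) * (?u y)^2 + 0 * (?u y)^3 + (1 / s^8) * (?u y)^4 = (?q y)\<^sup>2" for y
      using s(1) by (simp add: power2_diff field_simps) (simp add: eval_nat_numeral algebra_simps)
    moreover have "1 / s^4 + (- 2 / s^6) * s\<^sup>2 + 3 * (1 / s^8) * s^4 = 2 / s^4"
      using s(1) by (simp add: field_simps eval_nat_numeral)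
    ultimately show ?thesis
      using normal_moment_poly[OF s(1), of "\<beta> \<bullet> \<mu>" "1 / s^4" 0 "- 2 / s^6" 0 "1 / s^8"] by (simp only:)
  qed
  have "has_bochner_integral lborel (\<lambda>y. (?h y * (?p y)\<^sup>2) *\<^sub>R outer \<mu> \<mu>
      + (?h y * (?p y * ?q y)) *\<^sub>R (outer \<mu> v + outer v \<mu>) + (?h y * (?q y)\<^sup>2) *\<^sub>R outer v v)
     ((1 / s\<^sup>2) *\<^sub>R outer \<mu> \<mu> + 0 *\<^sub>R (outer \<mu> v + outer v \<mu>) + (2 / s^4) *\<^sub>R outer v v)"
    by (intro has_bochner_integral_add has_bochner_integral_scaleR_left pp pq qq)
  moreover have "(?h y * (?p y)\<^sup>2) *\<^sub>R outer \<mu> \<mu>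
      + (?h y * (?p y * ?q y)) *\<^sub>R (outer \<mu> v + outer v \<mu>) + (?h y * (?q y)\<^sup>2) *\<^sub>R outer v v
    = (1 / fY \<sigma> \<beta> \<mu> S y) *\<^sub>R outer (Avec \<sigma> \<beta> \<mu> S y) (Avec \<sigma> \<beta> \<mu> S y)" for y
  proof -
    have h: "?h y > 0" using s(1) by (rule normal_density_pos)
    have "(1 / fY \<sigma> \<beta> \<mu> S y) *\<^sub>R outer (Avec \<sigma> \<beta> \<mu> S y) (Avec \<sigma> \<beta> \<mu> S y)
       = ?h y *\<^sub>R outer (?p y *\<^sub>R \<mu> + ?q y *\<^sub>R v) (?p y *\<^sub>R \<mu> + ?q y *\<^sub>R v)"
      using h by (simp only: fY_eq Avec_eq normal_density_shift outer_scaleR_left outer_scaleR_right) simp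
    then show ?thesis
      by (simp only: outer_combination scaleR_add_right scaleR_scaleR)
  qed
  ultimately have "has_bochner_integral lborel
      (\<lambda>y. (1 / fY \<sigma> \<beta> \<mu> S y) *\<^sub>R outer (Avec \<sigma> \<beta> \<mu> S y) (Avec \<sigma> \<beta> \<mu> S y))
      ((1 / s\<^sup>2) *\<^sub>R outer \<mu> \<mu> + 0 *\<^sub>R (outer \<mu> v + outer v \<mu>) + (2 / s^4) *\<^sub>R outer v v)"
    by (simp only:)
  then show ?thesis
    unfolding Gamma1_def by (simp add: has_bochner_integral_integral_eq)
qed

text \<open>\<open>fY\<close> cancels the density inside \<open>Avec\<close>. Given x, the centred
  response is normal with mean \<open>w\<close> and variance \<sigma>^2, and averaging the two
  coefficients of \<open>Avec\<close> turns 1 / s^2 into \<tau>^2 / s^4 because s^2 - \<sigma>^2 =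
  \<tau>^2.\<close>

lemma Bvec_eq:
  fixes x defines "w \<equiv> \<beta> \<bullet> x - \<beta> \<bullet> \<mu>"
  shows "Bvec \<sigma> \<beta> \<mu> S x = (- (w / s\<^sup>2)) *\<^sub>R \<mu> + (- ((w\<^sup>2 - \<tau>\<^sup>2) / s^4)) *\<^sub>R v"
proof -
  let ?u = "\<lambda>y. y - \<beta> \<bullet> \<mu>" and ?d = "\<lambda>y. y - \<beta> \<bullet> x" and ?f = "normal_density (\<beta> \<bullet> x) \<sigma>"
  let ?p = "\<lambda>y. - (?u y / s\<^sup>2)" and ?q = "\<lambda>y. - ((?u y)\<^sup>2 / s^4 - 1 / s\<^sup>2)"
  have u: "?u y = ?d y + w" for y by (simp add: w_def)
  have p: "has_bochner_integral lborel (\<lambda>y. ?f y * ?p y) (- (w / s\<^sup>2))"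
  proof -
    have "- (w / s\<^sup>2) + (- 1 / s\<^sup>2) * ?d y + 0 * (?d y)^2 + 0 * (?d y)^3 + 0 * (?d y)^4 = ?p y" for y
      unfolding u by (simp add: add_divide_distrib)
    moreover have "- (w / s\<^sup>2) + 0 * \<sigma>\<^sup>2 + 3 * 0 * \<sigma>^4 = - (w / s\<^sup>2)" by simp
    ultimately show ?thesis
      using normal_moment_poly[OF \<sigma>, of "\<beta> \<bullet> x" "- (w / s\<^sup>2)" "- 1 / s\<^sup>2" 0 0 0] by (simp only:)
  qed
  have q: "has_bochner_integral lborel (\<lambda>y. ?f y * ?q y) (- ((w\<^sup>2 - \<tau>\<^sup>2) / s^4))"
  proof -
    have "- (w\<^sup>2 / s^4 - 1 / s\<^sup>2) + (- 2 * w / s^4) * ?d y + (- 1 / s^4) * (?d y)^2 + 0 * (?d y)^3 + 0 * (?d y)^4 = ?q y" for y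
      unfolding u by (simp add: power2_sum add_divide_distrib)
    moreover have "- (w\<^sup>2 / s^4 - 1 / s\<^sup>2) + (- 1 / s^4) * \<sigma>\<^sup>2 + 3 * 0 * \<sigma>^4 = - ((w\<^sup>2 - \<tau>\<^sup>2) / s^4)"
    proof -
      have "1 / s\<^sup>2 = s\<^sup>2 / s^4" using s(1) by (simp add: power2_eq_square power4_eq_xxxx)
      then show ?thesis by (simp add: s(2) add_divide_distrib diff_divide_distrib)
    qed
    ultimately show ?thesis
      using normal_moment_poly[OF \<sigma>, of "\<beta> \<bullet> x" "- (w\<^sup>2 / s^4 - 1 / s\<^sup>2)" "- 2 * w / s^4" "- 1 / s^4" 0 0] by (simp only:)
  qed
  have "has_bochner_integral lborel (\<lambda>y. (?f y * ?p y) *\<^sub>R \<mu> + (?f y * ?q y) *\<^sub>R v)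
     ((- (w / s\<^sup>2)) *\<^sub>R \<mu> + (- ((w\<^sup>2 - \<tau>\<^sup>2) / s^4)) *\<^sub>R v)"
    by (intro has_bochner_integral_add has_bochner_integral_scaleR_left p q)
  moreover have "(?f y * ?p y) *\<^sub>R \<mu> + (?f y * ?q y) *\<^sub>R v
    = (normal_density 0 \<sigma> (y - \<beta> \<bullet> x) / fY \<sigma> \<beta> \<mu> S y) *\<^sub>R Avec \<sigma> \<beta> \<mu> S y" for y
  proof -
    have "normal_density (\<beta> \<bullet> \<mu>) s y > 0" using s(1) by (rule normal_density_pos)
    then show ?thesis
      by (simp only: fY_eq Avec_eq normal_density_shift scaleR_scaleR scaleR_add_right) simp
  qed
  ultimately have "has_bochner_integral lborel
     (\<lambda>y. (normal_density 0 \<sigma> (y - \<beta> \<bullet> x) / fY \<sigma> \<beta> \<mu> S y) *\<^sub>R Avec \<sigma> \<beta> \<mu> S y)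
     ((- (w / s\<^sup>2)) *\<^sub>R \<mu> + (- ((w\<^sup>2 - \<tau>\<^sup>2) / s^4)) *\<^sub>R v)"
    by (simp only:)
  then show ?thesis
    unfolding Bvec_def by (rule has_bochner_integral_integral_eq)
qed

text \<open>With w = \<tau> z, where z is the coordinate \<open>k\<close>, the coefficients are
  multiples of the Hermite polynomials z and z^2 - 1. These are orthogonal under the standard normal
  law, with second moments 1 and 2.\<close>

lemma Gamma2_eq: "Gamma2 \<sigma> \<beta> \<mu> S = (\<tau>\<^sup>2 / s^4) *\<^sub>R outer \<mu> \<mu> + (2 * \<tau>^4 / s^8) *\<^sub>R outer v v"
proof -
  let ?p = "\<lambda>t. - (\<tau> * t / s\<^sup>2)" and ?q = "\<lambda>t. - (((\<tau> * t)\<^sup>2 - \<tau>\<^sup>2) / s^4)"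
  have pp: "has_bochner_integral lborel (\<lambda>t. std_normal_density t * (?p t)\<^sup>2) (\<tau>\<^sup>2 / s^4)"
  proof -
    have "0 + 0 * t + (\<tau>\<^sup>2 / s^4) * t^2 + 0 * t^3 + 0 * t^4 = (?p t)\<^sup>2" for t
      by (simp add: power_divide power_mult_distrib)
    moreover have "0 + \<tau>\<^sup>2 / s^4 + 3 * 0 = \<tau>\<^sup>2 / s^4" by simp
    ultimately show ?thesis
      using std_normal_moment_poly[of 0 0 "\<tau>\<^sup>2 / s^4" 0 0] by (simp only:)
  qed
  have pq: "has_bochner_integral lborel (\<lambda>t. std_normal_density t * (?p t * ?q t)) 0"
  proof -
    have "0 + (- (\<tau>^3 / s^6)) * t + 0 * t^2 + (\<tau>^3 / s^6) * t^3 + 0 * t^4 = ?p t * ?q t" for t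
      using s(1) by (simp add: field_simps eval_nat_numeral)
    moreover have "0 + 0 + 3 * 0 = (0::real)" by simp
    ultimately show ?thesis
      using std_normal_moment_poly[of 0 "- (\<tau>^3 / s^6)" 0 "\<tau>^3 / s^6" 0] by (simp only:)
  qed
  have qq: "has_bochner_integral lborel (\<lambda>t. std_normal_density t * (?q t)\<^sup>2) (2 * \<tau>^4 / s^8)"
  proof -
    have "\<tau>^4 / s^8 + 0 * t + (- 2 * \<tau>^4 / s^8) * t^2 + 0 * t^3 + (\<tau>^4 / s^8) * t^4 = (?q t)\<^sup>2" for t
      using s(1) by (simp add: power_divide field_simps) (simp add: eval_nat_numeral algebra_simps)
    moreover have "\<tau>^4 / s^8 + (- 2 * \<tau>^4 / s^8) + 3 * (\<tau>^4 / s^8) = 2 * \<tau>^4 / s^8" by simp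
    ultimately show ?thesis
      using std_normal_moment_poly[of "\<tau>^4 / s^8" 0 "- 2 * \<tau>^4 / s^8" 0 "\<tau>^4 / s^8"] by (simp only:)
  qed
  have "has_bochner_integral lborel (\<lambda>z. (std_normal_vec z * (?p (z $ k))\<^sup>2) *\<^sub>R outer \<mu> \<mu>
      + (std_normal_vec z * (?p (z $ k) * ?q (z $ k))) *\<^sub>R (outer \<mu> v + outer v \<mu>)
      + (std_normal_vec z * (?q (z $ k))\<^sup>2) *\<^sub>R outer v v)
     ((\<tau>\<^sup>2 / s^4) *\<^sub>R outer \<mu> \<mu> + 0 *\<^sub>R (outer \<mu> v + outer v \<mu>) + (2 * \<tau>^4 / s^8) *\<^sub>R outer v v)"
    by (intro has_bochner_integral_add has_bochner_integral_scaleR_left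
        std_normal_vec_marginal[OF pp] std_normal_vec_marginal[OF pq] std_normal_vec_marginal[OF qq])
  moreover have "(std_normal_vec z * (?p (z $ k))\<^sup>2) *\<^sub>R outer \<mu> \<mu>
      + (std_normal_vec z * (?p (z $ k) * ?q (z $ k))) *\<^sub>R (outer \<mu> v + outer v \<mu>)
      + (std_normal_vec z * (?q (z $ k))\<^sup>2) *\<^sub>R outer v v
    = std_normal_vec z *\<^sub>R outer (Bvec \<sigma> \<beta> \<mu> S (\<mu> + L *v z)) (Bvec \<sigma> \<beta> \<mu> S (\<mu> + L *v z))" for z
    by (simp only: Bvec_eq \<beta>_inner add_diff_cancel_left' outer_combination scaleR_add_right scaleR_scaleR)
  ultimately have "has_bochner_integral lborel
      (\<lambda>z. std_normal_vec z *\<^sub>R outer (Bvec \<sigma> \<beta> \<mu> S (\<mu> + L *v z)) (Bvec \<sigma> \<beta> \<mu> S (\<mu> + L *v z)))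
      ((\<tau>\<^sup>2 / s^4) *\<^sub>R outer \<mu> \<mu> + 0 *\<^sub>R (outer \<mu> v + outer v \<mu>) + (2 * \<tau>^4 / s^8) *\<^sub>R outer v v)"
    by (simp only:)
  moreover have "(\<lambda>x. outer (Bvec \<sigma> \<beta> \<mu> S x) (Bvec \<sigma> \<beta> \<mu> S x)) \<in> borel_measurable borel"
    unfolding Bvec_eq outer_combination by measurable
  ultimately have "has_bochner_integral lborel
      (\<lambda>x. mvn_density \<mu> S x *\<^sub>R outer (Bvec \<sigma> \<beta> \<mu> S x) (Bvec \<sigma> \<beta> \<mu> S x))
      ((\<tau>\<^sup>2 / s^4) *\<^sub>R outer \<mu> \<mu> + 0 *\<^sub>R (outer \<mu> v + outer v \<mu>) + (2 * \<tau>^4 / s^8) *\<^sub>R outer v v)"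
    by (intro has_bochner_integral_mvn_density[OF LL detL])
  then show ?thesis
    unfolding Gamma2_def by (simp add: has_bochner_integral_integral_eq)
qed

text \<open>L z has mean zero and covariance L L^T = S, so the second moment matrix is S + \<mu>
  \<mu>^T; the scalar in front is the Fisher information.\<close>

lemma Sigma2_eq: "Sigma2 \<sigma> \<mu> S = (1 / \<sigma>\<^sup>2) *\<^sub>R (S + outer \<mu> \<mu>)"
proof -
  have 1: "has_bochner_integral lborel (\<lambda>t. std_normal_density t * t) 0"
    using std_normal_moment_poly[of 0 1 0 0 0] by simp
  have 2: "has_bochner_integral lborel (\<lambda>t. std_normal_density t * (t * t)) 1"
    using std_normal_moment_poly[of 0 0 1 0 0] by (simp add: power2_eq_square)
  have cov: "has_bochner_integral lborel (\<lambda>z::real^'n. std_normal_vec z * (z $ i * z $ j)) (if i = j then 1 else 0)" for i j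
    using std_normal_vec_marginal[OF 2, of i] std_normal_vec_pair[OF 1 1, of j i] by auto
  have 0: "has_bochner_integral lborel (\<lambda>z::real^'n. std_normal_vec z) 1"
    using std_normal_vec_marginal[of "\<lambda>_. 1" 1] has_bochner_integral_std_normal_density by simp
  have lin: "outer (\<mu> + w) (\<mu> + w) = outer \<mu> \<mu> + (outer \<mu> w + outer w \<mu>) + outer w w" for w
    by (simp add: outer_add_left outer_add_right)
  have cross: "outer \<mu> (L *v z) + outer (L *v z) \<mu> = (\<Sum>j\<in>UNIV. z $ j *\<^sub>R (outer \<mu> (column j L) + outer (column j L) \<mu>))" for z
    by (simp add: outer_def vec_eq_iff matrix_vector_mult_def column_def sum_distrib_left sum_distrib_right
        sum.distrib[symmetric] algebra_simps)
  have "has_bochner_integral lborel (\<lambda>z. std_normal_vec z *\<^sub>R outer \<mu> \<mu>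
      + (\<Sum>j\<in>UNIV. (std_normal_vec z * z $ j) *\<^sub>R (outer \<mu> (column j L) + outer (column j L) \<mu>))
      + (\<Sum>i\<in>UNIV. \<Sum>j\<in>UNIV. (std_normal_vec z * (z $ i * z $ j)) *\<^sub>R outer (column i L) (column j L)))
     (1 *\<^sub>R outer \<mu> \<mu> + (\<Sum>j\<in>UNIV. 0 *\<^sub>R (outer \<mu> (column j L) + outer (column j L) \<mu>))
      + (\<Sum>i\<in>UNIV. \<Sum>j\<in>UNIV. (if i = j then 1 else 0) *\<^sub>R outer (column i L) (column j L)))"
    by (intro has_bochner_integral_add has_bochner_integral_sum has_bochner_integral_scaleR_left 0 cov
        std_normal_vec_marginal[OF 1])
  also have "(1 *\<^sub>R outer \<mu> \<mu> + (\<Sum>j\<in>UNIV. 0 *\<^sub>R (outer \<mu> (column j L) + outer (column j L) \<mu>))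
      + (\<Sum>i\<in>UNIV. \<Sum>j\<in>UNIV. (if i = j then 1 else 0) *\<^sub>R outer (column i L) (column j L))) = S + outer \<mu> \<mu>"
    by (simp add: if_distrib[of "\<lambda>x. x *\<^sub>R _"] sum_outer_column LL cong: if_cong)
  finally have "has_bochner_integral lborel (\<lambda>z. std_normal_vec z *\<^sub>R outer (\<mu> + L *v z) (\<mu> + L *v z)) (S + outer \<mu> \<mu>)"
    unfolding lin cross outer_matrix_vector_mult
    by (simp only: scaleR_add_right scaleR_sum_right scaleR_scaleR)
  moreover have "(\<lambda>x::real^'n. outer x x) \<in> borel_measurable borel"
    unfolding outer_def
    by (intro borel_measurable_continuous_onI continuous_intros)
  ultimately have "has_bochner_integral lborel (\<lambda>x. mvn_density \<mu> S x *\<^sub>R outer x x) (S + outer \<mu> \<mu>)"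
    by (intro has_bochner_integral_mvn_density[OF LL detL])
  then show ?thesis
    unfolding Sigma2_def by (simp add: has_bochner_integral_integral_eq integral_fisher_information[OF \<sigma>])
qed

section \<open>Determinants of the information matrices and the gain\<close>

definition "mean_sq = \<mu> \<bullet> (matrix_inv S *v \<mu>)"

text \<open>\<open>rel_det a b\<close> is the determinant of \<open>S + a \<mu> \<mu>\<^sup>T + b v v\<^sup>T\<close> relative to that of \<open>S\<close>.\<close>

definition "rel_det a b = (1 + a * mean_sq) * (1 + b * \<tau>\<^sup>2) - a * b * (\<mu> \<bullet> \<beta>)\<^sup>2"

text \<open>Common form of the three matrices in the gain: \<open>Sigma2\<close> is the case a = 1,
  b = 0, and adding the \<Gamma> terms only changes \<open>a\<close> and \<open>b\<close>.\<close>

definition "info_mat a b = (1 / \<sigma>\<^sup>2) *\<^sub>R (S + a *\<^sub>R outer \<mu> \<mu> + b *\<^sub>R outer v v)"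

text \<open>With m = L^-1 \<mu>, the lengths of \<open>m\<close> and \<tau> e_k and their inner
  product carry all invariants that enter \<open>rel_det\<close>.\<close>

lemma whitened_mean:
  obtains m where "L *v m = \<mu>" "m \<bullet> m = mean_sq" "m \<bullet> (\<tau> *\<^sub>R axis k 1) = \<mu> \<bullet> \<beta>"
proof -
  obtain L' where L': "L ** L' = mat 1"
    using detL by (metis invertible_def invertible_det_nz)
  define m where "m = L' *v \<mu>"
  have m: "L *v m = \<mu>"
    by (simp add: m_def matrix_vector_mul_assoc L')
  moreover have "m \<bullet> m = mean_sq"
    using inner_matrix_inv[OF LL detL, of m m] by (simp add: m mean_sq_def)
  moreover have "m \<bullet> (\<tau> *\<^sub>R axis k 1) = \<mu> \<bullet> \<beta>"
    by (simp only: L\<beta>[symmetric] inner_matrix_transpose[symmetric] m)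
  ultimately show thesis using that by blast
qed

text \<open>Cauchy-Schwarz in whitened coordinates bounds the subtracted mixed term. Positivity
  justifies the inverses and the square root in the gain.\<close>

lemma rel_det_pos: "rel_det a b > 0" if "a \<ge> 0" "b \<ge> 0"
proof -
  obtain m where m: "L *v m = \<mu>" "m \<bullet> m = mean_sq" "m \<bullet> (\<tau> *\<^sub>R axis k 1) = \<mu> \<bullet> \<beta>"
    by (rule whitened_mean)
  have "(\<mu> \<bullet> \<beta>)\<^sup>2 \<le> mean_sq * \<tau>\<^sup>2"
    using Cauchy_Schwarz_ineq[of m "\<tau> *\<^sub>R axis k 1"] m(2,3)
    by (simp add: power2_eq_square inner_axis_axis)
  then have "a * b * (\<mu> \<bullet> \<beta>)\<^sup>2 \<le> a * b * (mean_sq * \<tau>\<^sup>2)"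
    using that by (intro mult_left_mono) auto
  moreover have "mean_sq \<ge> 0" unfolding m(2)[symmetric] by simp
  then have "a * mean_sq \<ge> 0" "b * \<tau>\<^sup>2 \<ge> 0" using that by auto
  ultimately show ?thesis by (simp add: rel_det_def algebra_simps)
qed

text \<open>The matrix is congruent, via \<sigma>^-1 L, to the identity plus two rank-one terms
  built from \<open>m\<close> and \<tau> e_k.\<close>

lemma det_info_mat: "det (info_mat a b) = (det L / \<sigma> ^ CARD('n))\<^sup>2 * rel_det a b" if "a \<ge> 0"
proof -
  obtain m where m: "L *v m = \<mu>" "m \<bullet> m = mean_sq" "m \<bullet> (\<tau> *\<^sub>R axis k 1) = \<mu> \<bullet> \<beta>"
    by (rule whitened_mean)
  define e :: "real^'n" where "e = \<tau> *\<^sub>R axis k 1"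
  have e: "L *v e = v" by (simp add: e_def v_eq matrix_vector_mult_scaleR matrix_vector_mult_basis)
  define I where "I = mat 1 + a *\<^sub>R outer m m + b *\<^sub>R outer e e"
  have I: "I *v w = w + (a * (m \<bullet> w)) *\<^sub>R m + (b * (e \<bullet> w)) *\<^sub>R e" for w
    by (simp add: I_def matrix_vector_mult_add_rdistrib outer_mult_vec scaleR_matrix_vector_assoc[symmetric])
  \<comment> \<open>The scalar 1 / \<sigma>^2 is split into two scalar matrices, so that
    multiplicativity of \<open>det\<close> handles it.\<close>
  define R :: "real^'n^'n" where "R = mat (1 / \<sigma>)"
  have R: "R *v x = (1 / \<sigma>) *\<^sub>R x" for x
    by (simp add: R_def mat_def matrix_vector_mult_def vec_eq_iff if_distrib[of "\<lambda>c. c * _"] cong: if_cong)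
  have "info_mat a b *v x = (R ** L ** I ** transpose L ** R) *v x" for x
  proof -
    have q: "\<mu> \<bullet> x = m \<bullet> (transpose L *v x)" "v \<bullet> x = e \<bullet> (transpose L *v x)"
      using inner_matrix_transpose[of L m x] inner_matrix_transpose[of L e x] by (simp_all only: m(1) e)
    have Sx: "S *v x = L *v (transpose L *v x)"
      by (subst LL[symmetric]) (rule matrix_vector_mul_assoc[symmetric])
    have "info_mat a b *v x = (1 / \<sigma>\<^sup>2) *\<^sub>R (S *v x + (a * (\<mu> \<bullet> x)) *\<^sub>R \<mu> + (b * (v \<bullet> x)) *\<^sub>R v)"
      by (simp add: info_mat_def matrix_vector_mult_add_rdistrib outer_mult_vec scaleR_matrix_vector_assoc[symmetric])
    also have "\<dots> = (1 / \<sigma>\<^sup>2) *\<^sub>R (L *v (I *v (transpose L *v x)))"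
      by (simp only: Sx I matrix_vector_right_distrib matrix_vector_mult_scaleR m(1) e q)
    also have "\<dots> = (R ** L ** I ** transpose L ** R) *v x"
      by (simp only: matrix_vector_mul_assoc[symmetric] R matrix_vector_mult_scaleR scaleR_scaleR)
        (simp add: power2_eq_square)
    finally show ?thesis .
  qed
  then have "info_mat a b = R ** L ** I ** transpose L ** R"
    by (simp add: matrix_eq)
  then have "det (info_mat a b) = (det R * det L)\<^sup>2 * det I"
    by (simp add: det_mul power2_eq_square)
  also have "det R = 1 / \<sigma> ^ CARD('n)"
    unfolding R_def by (subst matrix_scaleR[symmetric], subst det_matrix_scaleR) (rule power_one_over)
  also have "det I = rel_det a b"
    unfolding I_def det_add_two_outer_I[OF that] m(2) rel_det_def
    using m(3) by (simp add: e_def power2_eq_square inner_axis_axis)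
  finally show ?thesis by simp
qed

text \<open>All determinants share the factor \<open>K\<close>. It occurs to the power -1 in the
  sandwich matrix and also in \<open>Sigma_OLS\<close>, hence cancels in the quotient.\<close>

lemma gain_eq:
  assumes lam: "lam > 0"
  shows "gain lam \<sigma> \<beta> \<mu> S = rel_det (1 + \<sigma>\<^sup>2 / (lam * s\<^sup>2)) (2 * \<sigma>\<^sup>2 / (lam * s^4))
    / sqrt (rel_det (1 + \<sigma>\<^sup>2 / lam * (1 / s\<^sup>2 + \<tau>\<^sup>2 / s^4)) (\<sigma>\<^sup>2 / lam * (2 / s^4 + 2 * \<tau>^4 / s^8)) * rel_det 1 0)"
    (is "_ = rel_det ?a ?b / sqrt (rel_det ?a' ?b' * rel_det 1 0)")
proof -
  define K where "K = (det L / \<sigma> ^ CARD('n))\<^sup>2"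
  have K: "K > 0" using detL \<sigma> by (simp add: K_def)
  have nonneg: "?a \<ge> 0" "?b \<ge> 0" "?a' \<ge> 0" "?b' \<ge> 0"
    using lam by auto
  note det = det_info_mat[OF nonneg(1), of ?b] det_info_mat[OF nonneg(3), of ?b'] det_info_mat[of 1 0, simplified]
  note det = det[folded K_def]
  note pos = rel_det_pos[OF nonneg(1,2)] rel_det_pos[OF nonneg(3,4)] rel_det_pos[of 1 0, simplified]
  have \<Sigma>: "Sigma2 \<sigma> \<mu> S = info_mat 1 0" by (simp add: Sigma2_eq info_mat_def)
  have P: "(1 / lam) *\<^sub>R Gamma1 \<sigma> \<beta> \<mu> S + Sigma2 \<sigma> \<mu> S = info_mat ?a ?b"
    using \<sigma> by (simp add: Sigma2_eq info_mat_def Gamma1_eq algebra_simps)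
  have Q: "(1 / lam) *\<^sub>R (Gamma1 \<sigma> \<beta> \<mu> S + Gamma2 \<sigma> \<beta> \<mu> S) + Sigma2 \<sigma> \<mu> S = info_mat ?a' ?b'"
    using \<sigma> by (simp add: Sigma2_eq info_mat_def Gamma1_eq Gamma2_eq algebra_simps)
  have "det (Sigma_SSL lam \<sigma> \<beta> \<mu> S) / det (Sigma_OLS \<sigma> \<mu> S) = rel_det ?a' ?b' * rel_det 1 0 / (rel_det ?a ?b)\<^sup>2"
    unfolding Sigma_SSL_def Sigma_OLS_def Let_def P Q unfolding \<Sigma>
  proof -
    have cancel: "inverse (K * d) * (K * d') * inverse (K * d) / inverse (K * d1) = d' * d1 / d\<^sup>2"
      if "d > 0" "d1 > 0" for d d' d1
      using K that by (simp add: power2_eq_square field_simps)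
    have nz: "det (info_mat ?a ?b) \<noteq> 0" "det (info_mat 1 0) \<noteq> 0"
      using K pos by (simp_all only: det) auto
    have "det (matrix_inv (info_mat ?a ?b) ** info_mat ?a' ?b' ** matrix_inv (info_mat ?a ?b)) / det (matrix_inv (info_mat 1 0))
      = inverse (K * rel_det ?a ?b) * (K * rel_det ?a' ?b') * inverse (K * rel_det ?a ?b) / inverse (K * rel_det 1 0)"
      unfolding det_mul det_matrix_inv[OF nz(1)] det_matrix_inv[OF nz(2)] det ..
    also have "\<dots> = rel_det ?a' ?b' * rel_det 1 0 / (rel_det ?a ?b)\<^sup>2"
      using pos(1,3) by (rule cancel)
    finally show "det (matrix_inv (info_mat ?a ?b) ** info_mat ?a' ?b' ** matrix_inv (info_mat ?a ?b)) / det (matrix_inv (info_mat 1 0))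
      = rel_det ?a' ?b' * rel_det 1 0 / (rel_det ?a ?b)\<^sup>2" .
  qed
  then have "gain lam \<sigma> \<beta> \<mu> S = inverse (sqrt (rel_det ?a' ?b' * rel_det 1 0 / (rel_det ?a ?b)\<^sup>2))"
    unfolding gain_def by (rule arg_cong)
  also have "inverse (sqrt (x / d\<^sup>2)) = d / sqrt x" if "d > 0" for x d :: real
    using that by (simp add: real_sqrt_divide)
  note this[OF pos(1)]
  finally show ?thesis .
qed

text \<open>Substituting \<tau>^2 = \<eta> \<sigma>^2 and s^2 = (\<eta> + 1) \<sigma>^2 eliminates
  the scale. \<open>A\<close> and \<open>T\<close> are the weights due to \<Gamma>1, and the extra
  factors under the root add \<Gamma>2. \<open>T\<close> is divided by \<tau>^2 because
  \<open>rel_det\<close> multiplies its second argument by \<tau>^2.\<close>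

lemma gain_eq_eta:
  assumes lam: "lam > 0"
  defines "\<eta> \<equiv> \<tau>\<^sup>2 / \<sigma>\<^sup>2"
  defines "A \<equiv> 1 / lam * (1 / (1 + \<eta>))" and "T \<equiv> 1 / lam * (2 * \<eta> / (\<eta> + 1)\<^sup>2)"
  shows "gain lam \<sigma> \<beta> \<mu> S = rel_det (1 + A) (T / \<tau>\<^sup>2)
    / sqrt (rel_det (1 + A * (1 + \<eta> / (\<eta> + 1))) (T * (1 + \<eta>\<^sup>2 / (\<eta> + 1)\<^sup>2) / \<tau>\<^sup>2) * rel_det 1 0)"
proof -
  have \<eta>: "\<eta> > 0" using \<sigma> \<tau> by (simp add: \<eta>_def)
  have t: "\<tau>\<^sup>2 = \<eta> * \<sigma>\<^sup>2" using \<sigma> by (simp add: \<eta>_def)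
  have c: "\<sigma>\<^sup>2 > 0" using \<sigma> by simp
  have s2: "s\<^sup>2 = (\<eta> + 1) * \<sigma>\<^sup>2" by (simp add: s(2) t algebra_simps)
  have pow: "s^4 = (s\<^sup>2)\<^sup>2" "s^8 = (s\<^sup>2)^4" "\<tau>^4 = (\<tau>\<^sup>2)\<^sup>2"
    by (simp_all flip: power_mult)
  \<comment> \<open>Stated for a positive \<open>c\<close> in place of \<sigma>^2, so that the
    fractions are simplified over a plain variable.\<close>
  have gen: "c / (lam * ((\<eta> + 1) * c)) = A"
    "2 * c / (lam * ((\<eta> + 1) * c)\<^sup>2) = T / (\<eta> * c)"
    "c / lam * (1 / ((\<eta> + 1) * c) + \<eta> * c / ((\<eta> + 1) * c)\<^sup>2) = A * (1 + \<eta> / (\<eta> + 1))"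
    "c / lam * (2 / ((\<eta> + 1) * c)\<^sup>2 + 2 * (\<eta> * c)\<^sup>2 / ((\<eta> + 1) * c)^4) = T * (1 + \<eta>\<^sup>2 / (\<eta> + 1)\<^sup>2) / (\<eta> * c)"
    if "c > 0" for c
  proof -
    define n where "n = \<eta> + 1"
    have n: "n > 0" "1 + \<eta> = n" "\<eta> + 1 = n" using \<eta> by (auto simp: n_def)
    show "c / (lam * ((\<eta> + 1) * c)) = A"
      unfolding A_def n using that n lam by (simp add: field_simps)
    show "2 * c / (lam * ((\<eta> + 1) * c)\<^sup>2) = T / (\<eta> * c)"
      unfolding T_def n using that n lam \<eta> by (simp add: field_simps power2_eq_square)
    show "c / lam * (1 / ((\<eta> + 1) * c) + \<eta> * c / ((\<eta> + 1) * c)\<^sup>2) = A * (1 + \<eta> / (\<eta> + 1))"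
      unfolding A_def n using that n(1) lam by (simp add: field_simps power2_eq_square)
    show "c / lam * (2 / ((\<eta> + 1) * c)\<^sup>2 + 2 * (\<eta> * c)\<^sup>2 / ((\<eta> + 1) * c)^4) = T * (1 + \<eta>\<^sup>2 / (\<eta> + 1)\<^sup>2) / (\<eta> * c)"
      unfolding T_def n using that n(1) lam \<eta> by (simp add: field_simps power2_eq_square power4_eq_xxxx)
  qed
  show ?thesis
    unfolding gain_eq[OF lam] pow s2 t gen[OF c] ..
qed

text \<open>\<zeta> is the cosine of the angle between the whitened mean and the axis of \<beta>,
  and 1 / (1 + \<rho>) equals \<open>mean_sq / (1 + mean_sq)\<close>. The extracted factor
  \<open>1 + mean_sq\<close> is \<open>rel_det 1 0\<close>.\<close>

lemma rel_det_normalized: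
  assumes "mean_sq > 0"
  defines "\<zeta> \<equiv> (\<mu> \<bullet> \<beta>) / (\<tau> * sqrt mean_sq)" and "\<rho> \<equiv> 1 / mean_sq"
  shows "rel_det (1 + A) (T / \<tau>\<^sup>2)
    = (1 + mean_sq) * (1 + A * (1 / (1 + \<rho>)) + T * (1 - \<zeta>\<^sup>2 / (1 + \<rho>)) + A * T * ((1 - \<zeta>\<^sup>2) / (1 + \<rho>)))"
proof -
  have z: "(\<mu> \<bullet> \<beta>)\<^sup>2 = \<zeta>\<^sup>2 * mean_sq * \<tau>\<^sup>2"
    using assms(1) \<tau> by (simp add: \<zeta>_def power_divide power_mult_distrib)
  have rel_det: "rel_det (1 + A) (T / \<tau>\<^sup>2) = (1 + (1 + A) * mean_sq) * (1 + T) - (1 + A) * T * (\<zeta>\<^sup>2 * mean_sq)"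
    using \<tau> by (simp add: rel_det_def z)
  have \<rho>: "x / (1 + \<rho>) = x * mean_sq / (1 + mean_sq)" for x
    using assms(1) by (simp add: \<rho>_def field_simps)
  have "1 + mean_sq > 0" using assms(1) by simp
  then show ?thesis
    unfolding rel_det \<rho> by (simp add: divide_simps) (simp add: algebra_simps)
qed

lemma rel_det_centered: "\<mu> = 0 \<Longrightarrow> rel_det a (T / \<tau>\<^sup>2) = 1 + T"
  unfolding rel_det_def mean_sq_def using \<tau> by simp

end

section \<open>Likelihood against least squares, and the closed forms of the gain\<close>

lemma is_arg_max_log_likelihood_iff:
  fixes Xs :: "nat \<Rightarrow> real^'n"
  assumes "\<sigma> > 0"
  shows "is_arg_max (\<lambda>b. \<Sum>k=1..m. ln (normal_density 0 \<sigma> (Ys k - b \<bullet> Xs k))) P \<beta>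
    \<longleftrightarrow> is_arg_min (\<lambda>b. \<Sum>k=1..m. (Ys k - b \<bullet> Xs k)\<^sup>2) P \<beta>"
proof -
  define c where "c = ln (1 / sqrt (2 * pi * \<sigma>\<^sup>2))"
  have "ln (normal_density 0 \<sigma> x) = c - x\<^sup>2 / (2 * \<sigma>\<^sup>2)" for x
    using assms by (simp add: normal_density_def c_def ln_mult ln_div)
  then have ll: "(\<Sum>k=1..m. ln (normal_density 0 \<sigma> (Ys k - b \<bullet> Xs k)))
      = real m * c - (\<Sum>k=1..m. (Ys k - b \<bullet> Xs k)\<^sup>2) / (2 * \<sigma>\<^sup>2)" for b
    by (simp add: sum_subtractf sum_divide_distrib)
  show ?thesis
    unfolding is_arg_max_def is_arg_min_def ll using assms by (simp add: divide_less_cancel)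
qed

theorem theorem3:
  fixes \<beta>0 \<mu>X :: "real^'p" and SX :: "real^'p^'p" and lam \<sigma> :: real
  assumes "0 < lam" "lam < 1" "\<beta>0 \<noteq> 0" "\<sigma> > 0" "pos_def_mat SX"
  defines "\<zeta> \<equiv> (\<mu>X \<bullet> \<beta>0) / (sqrt (\<beta>0 \<bullet> (SX *v \<beta>0)) * sqrt (\<mu>X \<bullet> (matrix_inv SX *v \<mu>X)))"
      and "\<rho> \<equiv> 1 / (\<mu>X \<bullet> (matrix_inv SX *v \<mu>X))"
      and "\<eta> \<equiv> (\<beta>0 \<bullet> (SX *v \<beta>0)) / \<sigma>\<^sup>2"
  shows
    "(\<forall>(m::nat) (Xs :: nat \<Rightarrow> real^'p) (Ys :: nat \<Rightarrow> real) \<beta>.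
        is_arg_max (\<lambda>b. \<Sum>k=1..m. ln (normal_density 0 \<sigma> (Ys k - b \<bullet> Xs k))) (\<lambda>_. True) \<beta>
        \<longleftrightarrow> is_arg_min (\<lambda>b. \<Sum>k=1..m. (Ys k - b \<bullet> Xs k)\<^sup>2) (\<lambda>_. True) \<beta>)
     \<and> (\<mu>X \<noteq> 0 \<longrightarrow>
        gain lam \<sigma> \<beta>0 \<mu>X SX =
          (1 + (1/lam) * ((1/(1+\<eta>)) * (1/(1+\<rho>)) + (2*\<eta>/(\<eta>+1)\<^sup>2) * (1 - \<zeta>\<^sup>2/(1+\<rho>)))
             + (1/lam\<^sup>2) * ((1 - \<zeta>\<^sup>2)/(1+\<rho>)) * (2*\<eta>/(\<eta>+1)^3))
          / sqrt (1 + (1/lam) * ((1/(1+\<eta>)) * (1/(1+\<rho>)) * (1 + \<eta>/(\<eta>+1))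
                     + (2*\<eta>/(\<eta>+1)\<^sup>2) * (1 - \<zeta>\<^sup>2/(1+\<rho>)) * (1 + \<eta>\<^sup>2/(\<eta>+1)\<^sup>2))
                  + (1/lam\<^sup>2) * ((1 - \<zeta>\<^sup>2)/(1+\<rho>)) * (2*\<eta>/(\<eta>+1)^3)
                     * (1 + \<eta>\<^sup>2/(\<eta>+1)\<^sup>2) * (1 + \<eta>/(\<eta>+1))))
     \<and> (\<mu>X = 0 \<longrightarrow>
        gain lam \<sigma> \<beta>0 \<mu>X SX =
          (1 + (2/lam) * (\<eta>/(\<eta>+1)\<^sup>2))
          / sqrt (1 + (2/lam) * (\<eta>/(\<eta>+1)\<^sup>2 + \<eta>^3/(\<eta>+1)^4)))"
proof (intro conjI impI allI)
  show "is_arg_max (\<lambda>b. \<Sum>k=1..m. ln (normal_density 0 \<sigma> (Ys k - b \<bullet> Xs k))) (\<lambda>_. True) \<beta>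
    \<longleftrightarrow> is_arg_min (\<lambda>b. \<Sum>k=1..m. (Ys k - b \<bullet> Xs k)\<^sup>2) (\<lambda>_. True) \<beta>"
    for m :: nat and Xs :: "nat \<Rightarrow> real^'p" and Ys :: "nat \<Rightarrow> real" and \<beta>
    using \<open>\<sigma> > 0\<close> by (rule is_arg_max_log_likelihood_iff)
next
  define \<tau> where "\<tau> = sqrt (\<beta>0 \<bullet> (SX *v \<beta>0))"
  define k :: 'p where "k = undefined"
  have q: "\<beta>0 \<bullet> (SX *v \<beta>0) > 0" using assms(3,5) by (simp add: pos_def_mat_def)
  then have \<tau>_pos: "\<tau> > 0" and \<tau>_sq: "\<tau>\<^sup>2 = \<beta>0 \<bullet> (SX *v \<beta>0)" by (simp_all add: \<tau>_def)
  obtain L where L: "L ** transpose L = SX" "det L \<noteq> 0" "transpose L *v \<beta>0 = \<tau> *\<^sub>R axis k 1"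
    using pos_def_square_root[OF assms(5,3), of k] unfolding \<tau>_def by metis
  interpret gaussian_model \<sigma> \<tau> \<beta>0 \<mu>X SX L k
    by unfold_locales (use assms(4) \<tau>_pos L in auto)
  have \<eta>: "\<eta> = \<tau>\<^sup>2 / \<sigma>\<^sup>2" by (simp only: \<eta>_def \<tau>_sq)
  have "\<eta> > 0" using \<tau>_pos assms(4) by (simp add: \<eta>)
  define A where "A = 1 / lam * (1 / (1 + \<eta>))"
  define T where "T = 1 / lam * (2 * \<eta> / (\<eta> + 1)\<^sup>2)"
  \<comment> \<open>The primed weights belong to the middle factor of the sandwich, which also
    contains \<Gamma>2.\<close>
  define A' where "A' = A * (1 + \<eta> / (\<eta> + 1))"
  define T' where "T' = T * (1 + \<eta>\<^sup>2 / (\<eta> + 1)\<^sup>2)"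
  have gain: "gain lam \<sigma> \<beta>0 \<mu>X SX = rel_det (1 + A) (T / \<tau>\<^sup>2) / sqrt (rel_det (1 + A') (T' / \<tau>\<^sup>2) * rel_det 1 0)"
    unfolding A_def T_def A'_def T'_def \<eta> by (rule gain_eq_eta[OF assms(1)])
  have rel_det_1_0: "rel_det 1 0 = 1 + mean_sq" by (simp add: rel_det_def)
  {
    assume "\<mu>X \<noteq> 0"
    obtain m where m: "L *v m = \<mu>X" "m \<bullet> m = mean_sq" "m \<bullet> (\<tau> *\<^sub>R axis k 1) = \<mu>X \<bullet> \<beta>0"
      by (rule whitened_mean)
    have "m \<noteq> 0" using m(1) \<open>\<mu>X \<noteq> 0\<close> by auto
    then have mean_sq: "mean_sq > 0" unfolding m(2)[symmetric] by simp
    have \<zeta>\<rho>: "\<zeta> = (\<mu>X \<bullet> \<beta>0) / (\<tau> * sqrt mean_sq)" "\<rho> = 1 / mean_sq"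
      by (simp_all add: \<zeta>_def \<rho>_def mean_sq_def \<tau>_def)
    define X Y Z where "X = 1 / (1 + \<rho>)" and "Y = (1 - \<zeta>\<^sup>2) / (1 + \<rho>)" and "Z = 1 - \<zeta>\<^sup>2 / (1 + \<rho>)"
    note rel_det = rel_det_normalized[OF mean_sq, folded \<zeta>\<rho>, folded X_def Y_def Z_def]
    have "1 + mean_sq > 0" using mean_sq by simp
    \<comment> \<open>Under the root one factor \<open>1 + mean_sq\<close> comes from the middle
      matrix and one from \<open>rel_det 1 0\<close>; together they cancel the factor in the
      numerator.\<close>
    have "gain lam \<sigma> \<beta>0 \<mu>X SX = (1 + mean_sq) * (1 + A * X + T * Z + A * T * Y)
        / sqrt ((1 + mean_sq)\<^sup>2 * (1 + A' * X + T' * Z + A' * T' * Y))"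
      unfolding gain rel_det rel_det_1_0 by (simp only: power2_eq_square mult_ac)
    also have "\<dots> = (1 + A * X + T * Z + A * T * Y) / sqrt (1 + A' * X + T' * Z + A' * T' * Y)"
      using \<open>1 + mean_sq > 0\<close> by (simp add: real_sqrt_mult)
    finally have g: "gain lam \<sigma> \<beta>0 \<mu>X SX = \<dots>" .
    have AT: "A * T = 1 / lam\<^sup>2 * (2 * \<eta> / (\<eta> + 1)^3)"
      by (simp add: A_def T_def power2_eq_square power3_eq_cube add.commute)
    have "1 + A * X + T * Z + A * T * Y
      = 1 + 1 / lam * (1 / (1 + \<eta>) * X + 2 * \<eta> / (\<eta> + 1)\<^sup>2 * Z) + 1 / lam\<^sup>2 * Y * (2 * \<eta> / (\<eta> + 1)^3)"
      unfolding AT unfolding A_def T_def by (simp only: distrib_left mult_ac add.assoc)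
    moreover have "1 + A' * X + T' * Z + A' * T' * Y
      = 1 + 1 / lam * (1 / (1 + \<eta>) * X * (1 + \<eta> / (\<eta> + 1)) + 2 * \<eta> / (\<eta> + 1)\<^sup>2 * Z * (1 + \<eta>\<^sup>2 / (\<eta> + 1)\<^sup>2))
        + 1 / lam\<^sup>2 * Y * (2 * \<eta> / (\<eta> + 1)^3) * (1 + \<eta>\<^sup>2 / (\<eta> + 1)\<^sup>2) * (1 + \<eta> / (\<eta> + 1))"
    proof -
      \<comment> \<open>\<open>u\<close> and \<open>w\<close> stand for the two factors contributed
        by \<Gamma>2; collecting them reduces the mixed term to the product \<open>A * T\<close>
        computed in \<open>AT\<close>.\<close>
      have e: "1 + a * u * X + t * w * Z + (a * u) * (t * w) * Y = 1 + (a * X * u + t * Z * w) + (a * t) * Y * w * u"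
        for a t u w :: real
        by (simp add: algebra_simps)
      show ?thesis
        unfolding A'_def T'_def e AT unfolding A_def T_def by (simp only: distrib_left mult_ac add.assoc)
    qed
    ultimately show "gain lam \<sigma> \<beta>0 \<mu>X SX =
          (1 + (1/lam) * ((1/(1+\<eta>)) * (1/(1+\<rho>)) + (2*\<eta>/(\<eta>+1)\<^sup>2) * (1 - \<zeta>\<^sup>2/(1+\<rho>)))
             + (1/lam\<^sup>2) * ((1 - \<zeta>\<^sup>2)/(1+\<rho>)) * (2*\<eta>/(\<eta>+1)^3))
          / sqrt (1 + (1/lam) * ((1/(1+\<eta>)) * (1/(1+\<rho>)) * (1 + \<eta>/(\<eta>+1))
                     + (2*\<eta>/(\<eta>+1)\<^sup>2) * (1 - \<zeta>\<^sup>2/(1+\<rho>)) * (1 + \<eta>\<^sup>2/(\<eta>+1)\<^sup>2))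
                  + (1/lam\<^sup>2) * ((1 - \<zeta>\<^sup>2)/(1+\<rho>)) * (2*\<eta>/(\<eta>+1)^3)
                     * (1 + \<eta>\<^sup>2/(\<eta>+1)\<^sup>2) * (1 + \<eta>/(\<eta>+1)))"
      unfolding g X_def[symmetric] Y_def[symmetric] Z_def[symmetric] by (simp only:)
  next
    assume "\<mu>X = 0"
    \<comment> \<open>With zero mean, \<zeta> and \<rho> would divide by zero, so the gain is read
      off from \<open>rel_det\<close> directly; only the weights along \<open>v\<close>
      remain.\<close>
    have "mean_sq = 0" unfolding mean_sq_def using \<open>\<mu>X = 0\<close> by simp
    have "gain lam \<sigma> \<beta>0 \<mu>X SX = (1 + T) / sqrt (1 + T')"
      unfolding gain rel_det_1_0 rel_det_centered[OF \<open>\<mu>X = 0\<close>] \<open>mean_sq = 0\<close> by simp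
    moreover have "T = (2/lam) * (\<eta>/(\<eta>+1)\<^sup>2)" by (simp add: T_def)
    moreover have "T' = (2/lam) * (\<eta>/(\<eta>+1)\<^sup>2 + \<eta>^3/(\<eta>+1)^4)"
    proof -
      have "1 / lam * (2 * e / n\<^sup>2) * (1 + e\<^sup>2 / n\<^sup>2) = (2/lam) * (e / n\<^sup>2 + e^3 / n^4)" for e n :: real
        by (simp add: distrib_left power2_eq_square power3_eq_cube power4_eq_xxxx)
      then show ?thesis unfolding T'_def T_def .
    qed
    ultimately show "gain lam \<sigma> \<beta>0 \<mu>X SX =
          (1 + (2/lam) * (\<eta>/(\<eta>+1)\<^sup>2))
          / sqrt (1 + (2/lam) * (\<eta>/(\<eta>+1)\<^sup>2 + \<eta>^3/(\<eta>+1)^4))"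
      by (simp only:)
  }
qed

end
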